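(* Let $p\ge11$ be a prime. Then, modulo $p^4$ in $\mathbb{Z}_p$, \begin{align*} A^\star_{p-3}\equiv-\frac{1}{p-3}\Bigg(&\frac{37p^3}{12}-3p^2+\frac{3p}{4}-p^2(pB_{p-1})+3p(p-3)\mathcal{B}_{p+1}-\frac{1}{2}\Big(p-3+\frac{11p^3}{2}\Big)B_{2p}\\ &+p^2(p-5)(\mathcal{B}_{p+3}-2\mathcal{B}_4)(2\mathcal{B}_{p-3}-\mathcal{B}_{2p-4})\\ &+2p(\mathcal{B}_{2p-4}-2\mathcal{B}_{p-3})\Big(p(2\mathcal{B}_4-\mathcal{B}_{p+3})+\frac{1}{2}\Big(\frac{7}{720}p^2+2p\mathcal{B}_{p+3}+2p\mathcal{B}_4(pB_{p-1})\Big)\Big)\\ &-\frac{p^3}{2}\Big(\frac{4}{3}\mathcal{T}(p+1)-\mathcal{C}(p-1)(\mathcal{B}_2+B_2)-\mathcal{C}(p-3)(\mathcal{B}_4+B_4)-\mathcal{B}_2^2(\mathcal{B}_{p-3}+B_{p-3})\Big)\\ &+p^2(1+pw_p)\frac{p-3}{2}\Big(2\mathcal{B}_4\mathcal{B}_{p-3}-\mathcal{TC}(4)\Big)-\frac{p^3}{2}\sum_{a=1}^{p-1}\Bigg(\sum_{i=6}^{p-5}\frac{B_i-2\mathcal{B}_i}{a^i}\Bigg)(aq_a)^2\Bigg)\pmod{p^4}. \end{align*}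
   Context: $A^\star_k:=\sum_{1\le i_1<\dots<i_k\le p-1}\frac{1}{i_1\cdots i_k}$. $w_p:=\frac{(p-1)!+1}{p}$ and $q_a:=\frac{a^{p-1}-1}{p}$ (Fermat quotient). $B_n$ is the $n$-th Bernoulli number, $\mathcal{B}_n:=B_n/n$ for $n\ge1$; for even $m\ge4$, $\mathcal{C}(m):=\sum_{i=2}^{m-2}\mathcal{B}_i\mathcal{B}_{m-i}$ and $\mathcal{T}(m):=\sum_{i=2}^{m-4}\mathcal{B}_i\mathcal{C}(m-i)$. The truncated convolution is $\mathcal{TC}(4):=\sum_{i=4}^{p-3}\mathcal{B}_i\mathcal{B}_{p+1-i}$. $x\equiv y\pmod{p^4}$ means $x-y\in p^4\mathbb{Z}_p$. *)

theory Defs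
  imports "HOL-Computational_Algebra.Computational_Algebra"
begin

text \<open>
  Bernoulli numbers, from the generating function \<open>t / (exp t - 1)\<close>.
  The division is the one of formal power series, which cancels the common factor \<open>t\<close>.
\<close>

definition bernoulli :: "nat \<Rightarrow> rat" where
  "bernoulli n = fact n * fps_nth (fps_X / (fps_exp 1 - 1)) n"

lemma bernoulli_generating_function:
  "Abs_fps (\<lambda>n. bernoulli n / fact n) * (fps_exp 1 - 1) = (fps_X :: rat fps)"
proof -
  have "Abs_fps (\<lambda>n. bernoulli n / fact n) = fps_X / (fps_exp 1 - 1)"
    by (simp add: fps_eq_iff bernoulli_def)
  moreover have "fps_nth (fps_exp 1 - 1 :: rat fps) 1 \<noteq> 0"
    by simp
  then have "(fps_exp 1 - 1 :: rat fps) \<noteq> 0"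
    by fastforce
  moreover have "subdegree (fps_exp 1 - 1 :: rat fps) = 1"
    by (rule subdegreeI) auto
  ultimately show ?thesis
    by (simp add: fps_dvd_iff)
qed

definition divided_bernoulli :: "nat \<Rightarrow> rat" ("\<B>") where
  "\<B> n = bernoulli n / of_nat n"

definition bernoulli_conv :: "nat \<Rightarrow> rat" ("\<C>") where
  "\<C> m = (\<Sum>i = 2..m - 2. \<B> i * \<B> (m - i))"

definition bernoulli_triple_conv :: "nat \<Rightarrow> rat" ("\<T>") where
  "\<T> m = (\<Sum>i = 2..m - 4. \<B> i * \<C> (m - i))"

definition truncated_conv4 :: "nat \<Rightarrow> rat" where
  "truncated_conv4 p = (\<Sum>i = 4..p - 3. \<B> i * \<B> (p + 1 - i))"

definition wilson_quotient :: "nat \<Rightarrow> rat" where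
  "wilson_quotient p = (fact (p - 1) + 1) / of_nat p"

definition fermat_quotient :: "nat \<Rightarrow> nat \<Rightarrow> rat" where
  "fermat_quotient p a = (of_nat a ^ (p - 1) - 1) / of_nat p"

text \<open>
  The index tuples \<open>i\<^sub>1 < \<dots> < i\<^sub>k\<close> are represented by the \<open>k\<close>-element sets of their entries.
\<close>

definition A_star :: "nat \<Rightarrow> nat \<Rightarrow> rat" where
  "A_star p k = (\<Sum>I | I \<subseteq> {1..p - 1} \<and> card I = k. 1 / (\<Prod>i\<in>I. of_nat i))"

text \<open>
  For prime \<open>p\<close>, a rational number is a \<open>p\<close>-adic integer iff it is a fraction whose denominator
  is prime to \<open>p\<close>. For rational \<open>x\<close> and \<open>y\<close>, the congruence below is
  \<open>x - y \<in> p\<^sup>n \<int>\<^sub>p\<close>. Note that \<open>\<not> int p dvd b\<close> implies \<open>b \<noteq> 0\<close>.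
\<close>

definition rat_padic_ints :: "nat \<Rightarrow> rat set" where
  "rat_padic_ints p = {of_int a / of_int b | a b. \<not> int p dvd b}"

definition padic_cong :: "nat \<Rightarrow> nat \<Rightarrow> rat \<Rightarrow> rat \<Rightarrow> bool" where
  "padic_cong p n x y \<longleftrightarrow> (\<exists>z \<in> rat_padic_ints p. x - y = of_nat p ^ n * z)"

end

theory Submission
  imports Defs "HOL-Number_Theory.Number_Theory"
begin

text \<open>
  Let \<open>e\<^sub>n\<close> be the elementary symmetric functions of \<open>1, \<dots>, p - 1\<close>, \<open>S\<^sub>n\<close> their power sums and
  \<open>v = - (p - 1)! = 1 - p w\<close>. Then \<open>A\<^sup>\<star>\<^sub>p\<^sub>-\<^sub>3 = - e\<^sub>2 / v\<close>, and the Bernoulli numbers enter through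
  \<open>S\<^sub>n / n \<equiv> p B\<^sub>n / n + p\<^sup>3 (n - 1) B\<^sub>n\<^sub>-\<^sub>2 / 6 (mod p\<^sup>4)\<close> for even \<open>n \<ge> 6\<close>.
  Factor the generating function as \<open>\<Prod>(1 + a X) = (1 - v X\<^sup>p\<^sup>-\<^sup>1) (1 + \<delta>)\<close>. All coefficients of
  \<open>\<delta>\<close> are divisible by \<open>p\<close> and satisfy \<open>\<delta>\<^sub>n\<^sub>+\<^sub>p\<^sub>-\<^sub>1 = v \<delta>\<^sub>n\<close>, so the logarithm, whose coefficients are
  the \<open>\<plusminus> S\<^sub>n / n\<close>, is \<open>\<delta> - \<delta>\<^sup>2 / 2 + \<delta>\<^sup>3 / 3\<close> modulo \<open>p\<^sup>4\<close> away from multiples of \<open>p - 1\<close>. At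
  \<open>n = p + 1\<close> and \<open>n = 2 p\<close> the coefficients share the leading terms \<open>v e\<^sub>2\<close> and \<open>v\<^sup>2 e\<^sub>2\<close>, which
  expresses \<open>e\<^sub>2 / v\<close> by \<open>B\<^sub>p\<^sub>+\<^sub>1\<close>, \<open>B\<^sub>2\<^sub>p\<close> and convolutions of the \<open>e\<^sub>n\<close>. Modulo \<open>p\<^sup>2\<close> one has
  \<open>e\<^sub>n \<equiv> - p B\<^sub>n / n\<close>, which turns these into convolutions of Bernoulli numbers. The sum over the
  squared Fermat quotients is a second difference of power sums, hence also such a convolution.
\<close>

subsection \<open>Powers of p in the p-adic integers\<close>

definition padic_ideal :: "nat \<Rightarrow> nat \<Rightarrow> rat set" where
  "padic_ideal p k = {of_nat p ^ k * z | z. z \<in> rat_padic_ints p}"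

locale prime_padic =
  fixes p :: nat
  assumes prime_p: "prime p"
begin

abbreviation P :: rat where "P \<equiv> of_nat p"
abbreviation I :: "nat \<Rightarrow> rat set" where "I \<equiv> padic_ideal p"

lemma p_nonzero [simp]: "p \<noteq> 0"
  using prime_p by (auto simp: prime_gt_0_nat)

lemma p_pos: "p > 0"
  using prime_p by (simp add: prime_gt_0_nat)

lemma I_0: "I 0 = rat_padic_ints p"
  by (simp add: padic_ideal_def)

lemma padic_cong_iff: "padic_cong p k x y \<longleftrightarrow> x - y \<in> I k"
  by (auto simp: padic_cong_def padic_ideal_def)

lemma int_p_prime: "prime (int p)"
  using prime_p by simp

lemma rat_padic_intsI: "\<not> int p dvd b \<Longrightarrow> x * of_int b = of_int a \<Longrightarrow> x \<in> rat_padic_ints p"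
proof -
  assume b: "\<not> int p dvd b" and e: "x * of_int b = of_int a"
  then have "b \<noteq> 0" by auto
  with e have "x = of_int a / of_int b" by (simp add: field_simps)
  with b show ?thesis by (auto simp: rat_padic_ints_def)
qed

lemma rat_padic_intsE:
  assumes "x \<in> rat_padic_ints p"
  obtains a b where "\<not> int p dvd b" "b \<noteq> 0" "x = of_int a / of_int b"
  using assms by (auto simp: rat_padic_ints_def)

lemma of_int_padic: "of_int n \<in> rat_padic_ints p"
  using prime_p by (intro rat_padic_intsI[of 1 _ n]) (auto dest: prime_gt_1_nat)

lemma padic_add: "x \<in> rat_padic_ints p \<Longrightarrow> y \<in> rat_padic_ints p \<Longrightarrow> x + y \<in> rat_padic_ints p"
proof -
  assume "x \<in> rat_padic_ints p" "y \<in> rat_padic_ints p"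
  then obtain a b c d where "\<not> int p dvd b" "b \<noteq> 0" "x = of_int a / of_int b"
    "\<not> int p dvd d" "d \<noteq> 0" "y = of_int c / of_int d"
    by (elim rat_padic_intsE) blast
  then show ?thesis
    by (intro rat_padic_intsI[of "b * d" _ "a * d + c * b"])
      (auto simp: field_simps prime_dvd_mult_iff[OF int_p_prime])
qed

lemma padic_mult: "x \<in> rat_padic_ints p \<Longrightarrow> y \<in> rat_padic_ints p \<Longrightarrow> x * y \<in> rat_padic_ints p"
proof -
  assume "x \<in> rat_padic_ints p" "y \<in> rat_padic_ints p"
  then obtain a b c d where "\<not> int p dvd b" "b \<noteq> 0" "x = of_int a / of_int b"
    "\<not> int p dvd d" "d \<noteq> 0" "y = of_int c / of_int d"
    by (elim rat_padic_intsE) blast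
  then show ?thesis
    by (intro rat_padic_intsI[of "b * d" _ "a * c"])
      (auto simp: field_simps prime_dvd_mult_iff[OF int_p_prime])
qed

lemma I_iff: "x \<in> I k \<longleftrightarrow> x / P ^ k \<in> rat_padic_ints p"
proof -
  have "x = P ^ k * (x / P ^ k)" by simp
  moreover have "(P ^ k * z) / P ^ k = z" for z by simp
  ultimately show ?thesis unfolding padic_ideal_def by (smt (verit) mem_Collect_eq)
qed

lemma I_zero [simp]: "0 \<in> I k"
  using of_int_padic[of 0] by (simp add: I_iff)

lemma I_add: "x \<in> I k \<Longrightarrow> y \<in> I k \<Longrightarrow> x + y \<in> I k"
  by (simp add: I_iff add_divide_distrib padic_add)

lemma I_mult: "x \<in> I k \<Longrightarrow> y \<in> I l \<Longrightarrow> x * y \<in> I (k + l)"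
  using padic_mult[of "x / P ^ k" "y / P ^ l"] by (simp add: I_iff power_add)

lemma of_int_I: "of_int n \<in> I 0"
  by (simp add: I_0 of_int_padic)

lemma of_nat_I [simp]: "of_nat n \<in> I 0"
  using of_int_I[of "int n"] by simp

lemma numeral_I [simp]: "numeral n \<in> I 0"
  using of_nat_I[of "numeral n"] by simp

lemma one_I [simp]: "1 \<in> I 0"
  using of_nat_I[of 1] by simp

lemma I_mult_left: "c \<in> I 0 \<Longrightarrow> x \<in> I k \<Longrightarrow> c * x \<in> I k"
  using I_mult[of c 0 x k] by simp

lemma I_mult_right: "x \<in> I k \<Longrightarrow> c \<in> I 0 \<Longrightarrow> x * c \<in> I k"
  using I_mult[of x k c 0] by simp

lemma I_minus: "x \<in> I k \<Longrightarrow> - x \<in> I k"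
  using I_mult_left[of "of_int (-1)" x k] of_int_I[of "-1"] by simp

lemma I_minus_iff [simp]: "- x \<in> I k \<longleftrightarrow> x \<in> I k"
  using I_minus[of x k] I_minus[of "- x" k] by auto

lemma I_diff: "x \<in> I k \<Longrightarrow> y \<in> I k \<Longrightarrow> x - y \<in> I k"
  using I_add[of x k "- y"] by simp

lemma I_sum: "(\<And>i. i \<in> A \<Longrightarrow> f i \<in> I k) \<Longrightarrow> sum f A \<in> I k"
  by (induction A rule: infinite_finite_induct) (auto intro: I_add)

lemma P_power_I [simp]: "P ^ k \<in> I k"
  using of_int_padic[of 1] by (simp add: I_iff)

lemma P_I [simp]: "P \<in> I (Suc 0)"
  using P_power_I[of 1] by simp

lemma I_antimono: "x \<in> I k \<Longrightarrow> l \<le> k \<Longrightarrow> x \<in> I l"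
proof -
  assume x: "x \<in> I k" and l: "l \<le> k"
  have "x / P ^ k * P ^ (k - l) \<in> rat_padic_ints p"
    using x of_nat_I[of "p ^ (k - l)"] unfolding I_0 by (intro padic_mult) (auto simp: I_iff)
  also have "x / P ^ k * P ^ (k - l) = x / P ^ l"
    using l by (simp add: power_diff)
  finally show ?thesis by (simp add: I_iff)
qed

lemma I_integral: "x \<in> I k \<Longrightarrow> x \<in> I 0"
  by (erule I_antimono) simp

lemma I_mult_ge: "x \<in> I k \<Longrightarrow> y \<in> I l \<Longrightarrow> n \<le> k + l \<Longrightarrow> x * y \<in> I n"
  using I_mult I_antimono by blast

lemma P_power_mult_I_iff: "P ^ l * x \<in> I (k + l) \<longleftrightarrow> x \<in> I k"
  by (simp add: I_iff power_add)

lemma P_mult_I_iff: "P * x \<in> I (Suc k) \<longleftrightarrow> x \<in> I k"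
  using P_power_mult_I_iff[of 1 x k] by simp

lemma I_power: "x \<in> I k \<Longrightarrow> x ^ n \<in> I (k * n)"
proof (induction n)
  case (Suc n)
  then show ?case using I_mult[of x k "x ^ n" "k * n"] by simp
qed simp

lemma I_power_0: "x \<in> I 0 \<Longrightarrow> x ^ n \<in> I 0"
  using I_power[of x 0 n] by simp

lemma inverse_unit_I:
  assumes "\<not> p dvd n" shows "1 / of_nat n \<in> I 0"
proof -
  have "n \<noteq> 0" using assms by (metis dvd_0_right)
  then have "1 / of_nat n * of_int (int n) = (of_int 1 :: rat)" by simp
  then show ?thesis
    using assms unfolding I_0 by (intro rat_padic_intsI[of "int n" _ 1]) auto
qed

lemma inverse_less_I: "0 < n \<Longrightarrow> n < p \<Longrightarrow> 1 / of_nat n \<in> I 0"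
  by (rule inverse_unit_I) (auto dest: dvd_imp_le)

lemma I_div_unit: "x \<in> I k \<Longrightarrow> \<not> p dvd n \<Longrightarrow> x / of_nat n \<in> I k"
  using I_mult_right[OF _ inverse_unit_I, of x k n] by simp

text \<open>If p^v is the exact power of p in n, then p^v <= n < p^(k+1) forces v <= k. This bound
  absorbs the denominators of the power-sum formula and of the logarithm.\<close>

lemma p_power_div_I:
  assumes "0 < n" "n < p ^ Suc k"
  shows "P ^ k / of_nat n \<in> I 0"
proof -
  obtain m where m: "n = p ^ multiplicity p n * m" "\<not> p dvd m"
    using assms prime_p by (metis multiplicity_decompose' not_prime_unit neq0_conv)
  define v where "v = multiplicity p n"
  have "m > 0" using m(2) by (cases m) auto
  then have "p ^ v \<le> n" using m(1) unfolding v_def by (metis Suc_leI mult.right_neutral mult_le_mono2 One_nat_def)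
  then have "p ^ v < p ^ Suc k" using assms by simp
  then have "v \<le> k" using prime_p
    by (metis less_Suc_eq_le power_less_imp_less_exp prime_gt_1_nat)
  have "P ^ k / of_nat n = P ^ (k - v) / of_nat m"
    using \<open>v \<le> k\<close> by (subst m(1)) (simp add: v_def[symmetric] power_diff)
  also have "\<dots> \<in> I 0"
    using m(2) by (intro I_div_unit I_power_0) auto
  finally show ?thesis .
qed

text \<open>The difference splits as x (y - y') + (x - x') y', so each congruence gains precision
  from the power of p in the other factor.\<close>

lemma cong_mult:
  assumes "x - x' \<in> I k" "y - y' \<in> I l" "x \<in> I a" "y' \<in> I b" "n \<le> k + b" "n \<le> a + l"
  shows "x * y - x' * y' \<in> I n"
proof -
  have "x * y - x' * y' = x * (y - y') + (x - x') * y'" by (simp add: algebra_simps)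
  then show ?thesis using assms by (auto intro!: I_add intro: I_mult_ge)
qed

lemma I_trans: "x - y \<in> I k \<Longrightarrow> y - z \<in> I k \<Longrightarrow> x - z \<in> I k"
  using I_add[of "x - y" k "y - z"] by simp

lemma I_cong: "x - y \<in> I k \<Longrightarrow> y \<in> I k \<Longrightarrow> x \<in> I k"
  using I_add[of "x - y" k y] by simp

lemma I_diff_commute: "x - y \<in> I k \<longleftrightarrow> y - x \<in> I k"
  using I_minus_iff[of "x - y" k] by (simp del: I_minus_iff)

end

subsection \<open>Bernoulli numbers\<close>

lemma fps_exp_1_minus_1_nonzero: "fps_exp 1 - 1 \<noteq> (0 :: rat fps)"
proof -
  have "fps_nth (fps_exp 1 - 1 :: rat fps) 1 \<noteq> 0" by simp
  then show ?thesis by fastforce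
qed

text \<open>Faulhaber's formula. The series exp(a t) for a < N form a geometric sum with value
  (exp(N t) - 1) / (exp t - 1). Cancelling a factor t in the numerator leaves \<open>F\<close> times
  the Bernoulli series.\<close>

lemma sum_powers_bernoulli:
  "(\<Sum>a<N. (of_nat a :: rat) ^ n) =
     (\<Sum>k\<le>n. of_nat (n choose k) * of_nat N ^ Suc k / of_nat (Suc k) * bernoulli (n - k))"
proof -
  define E where "E = (fps_exp 1 - 1 :: rat fps)"
  define Bf where "Bf = Abs_fps (\<lambda>n. bernoulli n / fact n)"
  define F where "F = Abs_fps (\<lambda>k. (of_nat N :: rat) ^ Suc k / fact (Suc k))"
  have BE: "Bf * E = fps_X"
    unfolding Bf_def E_def by (rule bernoulli_generating_function)
  have "(\<Sum>a<M. fps_exp (of_nat a)) * E = fps_exp (of_nat M) - 1" for M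
    by (induction M) (simp_all add: E_def algebra_simps fps_exp_add_mult)
  moreover have "fps_exp (of_nat N) - 1 = fps_X * F"
    by (rule fps_ext) (auto simp: F_def gr0_conv_Suc)
  ultimately have "(\<Sum>a<N. fps_exp (of_nat a)) * E = (F * Bf) * E"
    using BE by (metis mult.assoc mult.commute)
  then have "(\<Sum>a<N. fps_exp (of_nat a)) = F * Bf"
    using fps_exp_1_minus_1_nonzero by (simp add: E_def)
  then have "fps_nth (\<Sum>a<N. fps_exp (of_nat a)) n = fps_nth (F * Bf) n"
    by simp
  then have "(\<Sum>a<N. (of_nat a :: rat) ^ n / fact n) = (\<Sum>k\<le>n. fps_nth F k * fps_nth Bf (n - k))"
    by (simp add: fps_sum_nth fps_mult_nth atLeast0AtMost)
  then have "(\<Sum>a<N. (of_nat a :: rat) ^ n) = (\<Sum>k\<le>n. fact n * (fps_nth F k * fps_nth Bf (n - k)))"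
    by (simp add: sum_divide_distrib[symmetric] sum_distrib_left[symmetric] field_simps)
  also have "\<dots> = (\<Sum>k\<le>n. of_nat (n choose k) * of_nat N ^ Suc k / of_nat (Suc k) * bernoulli (n - k))"
  proof (rule sum.cong[OF refl])
    fix k assume "k \<in> {..n}"
    then have "(of_nat (n choose k) :: rat) = fact n / (fact k * fact (n - k))"
      by (simp add: binomial_fact)
    then show "fact n * (fps_nth F k * fps_nth Bf (n - k)) =
      of_nat (n choose k) * of_nat N ^ Suc k / of_nat (Suc k) * bernoulli (n - k)"
      by (simp add: F_def Bf_def mult_ac)
  qed
  finally show ?thesis .
qed

lemma bernoulli_0: "bernoulli 0 = 1"
  using sum_powers_bernoulli[of 0 1] by simp

text \<open>The power-sum formula for N = 1, where the left side is 0^n = 0.\<close>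

lemma bernoulli_rec:
  assumes "n > 0"
  shows "bernoulli n = - (\<Sum>k=1..n. of_nat (n choose k) / of_nat (Suc k) * bernoulli (n - k))"
proof -
  have "{..n} = insert 0 {1..n}" by auto
  then show ?thesis
    using sum_powers_bernoulli[of n 1] assms by (simp add: eq_neg_iff_add_eq_0 zero_power)
qed

lemma bernoulli_1: "bernoulli 1 = - 1 / 2"
  by (subst bernoulli_rec) (simp_all add: bernoulli_0)

lemma bernoulli_2: "bernoulli 2 = 1 / 6"
proof -
  have "{1..2::nat} = {1, 2}" by auto
  then show ?thesis by (subst bernoulli_rec) (simp_all add: bernoulli_0 bernoulli_1[unfolded One_nat_def])
qed

lemma bernoulli_3: "bernoulli 3 = 0"
proof -
  have "{1..3::nat} = {1, 2, 3}" by auto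
  then show ?thesis
    by (subst bernoulli_rec) (simp_all add: bernoulli_0 bernoulli_1[unfolded One_nat_def] bernoulli_2
      binomial_code fold_atLeastAtMost_nat.simps)
qed

lemma bernoulli_4: "bernoulli 4 = - 1 / 30"
proof -
  have "{1..4::nat} = {1, 2, 3, 4}" by auto
  then show ?thesis
    by (subst bernoulli_rec) (simp_all add: bernoulli_0 bernoulli_1[unfolded One_nat_def] bernoulli_2 bernoulli_3
      binomial_code fold_atLeastAtMost_nat.simps)
qed

text \<open>Substituting -t for t, which is \<open>tw\<close>, changes t / (exp t - 1) only by
  adding t. Hence an odd coefficient beyond the first equals its own negative.\<close>

lemma bernoulli_odd_eq_0:
  assumes "odd n" "n \<ge> 3"
  shows "bernoulli n = 0"
proof -
  define E where "E = (fps_exp 1 - 1 :: rat fps)"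
  define Bf where "Bf = Abs_fps (\<lambda>n. bernoulli n / fact n)"
  define tw where "tw = (\<lambda>f :: rat fps. Abs_fps (\<lambda>n. (-1) ^ n * fps_nth f n))"
  have tw_mult: "tw (f * g) = tw f * tw g" for f g
  proof (rule fps_ext)
    fix m
    have "fps_nth (tw f * tw g) m = (\<Sum>i=0..m. (-1) ^ i * fps_nth f i * ((-1) ^ (m - i) * fps_nth g (m - i)))"
      by (simp add: tw_def fps_mult_nth)
    also have "\<dots> = (\<Sum>i=0..m. (-1) ^ m * (fps_nth f i * fps_nth g (m - i)))"
    proof (rule sum.cong[OF refl])
      fix i assume "i \<in> {0..m}"
      then have "(-1 :: rat) ^ m = (-1) ^ i * (-1) ^ (m - i)" by (simp add: power_add[symmetric])
      then show "(-1) ^ i * fps_nth f i * ((-1) ^ (m - i) * fps_nth g (m - i)) =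
        (-1) ^ m * (fps_nth f i * fps_nth g (m - i))" by simp
    qed
    finally show "fps_nth (tw (f * g)) m = fps_nth (tw f * tw g) m"
      by (simp add: tw_def fps_mult_nth sum_distrib_left)
  qed
  have BE: "Bf * E = fps_X"
    unfolding Bf_def E_def by (rule bernoulli_generating_function)
  have twX: "tw fps_X = - fps_X" by (rule fps_ext) (simp add: tw_def fps_X_def)
  have twE: "tw E = fps_exp (-1) - 1" by (rule fps_ext) (simp add: tw_def E_def)
  have ee: "fps_exp 1 * fps_exp (-1) = (1 :: rat fps)"
    by (simp add: fps_exp_add_mult[symmetric])
  have "tw E * fps_exp 1 = - E"
    unfolding twE using ee by (simp add: E_def algebra_simps)
  moreover have "tw Bf * tw E = - fps_X"
    by (simp add: tw_mult[symmetric] BE twX)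
  ultimately have "tw Bf * (- E) = - fps_X * fps_exp 1"
    by (metis mult.assoc)
  also have "\<dots> = (Bf * fps_exp 1) * (- E)"
    by (simp add: BE[symmetric] mult_ac)
  finally have "tw Bf = Bf * fps_exp 1"
    using fps_exp_1_minus_1_nonzero by (simp add: E_def)
  also have "\<dots> = fps_X + Bf"
    using BE by (simp add: E_def algebra_simps)
  finally have "fps_nth (tw Bf) n = fps_nth (fps_X + Bf) n" by simp
  with assms show ?thesis
    by (auto simp: tw_def Bf_def fps_X_def)
qed

lemma divided_bernoulli_2: "\<B> 2 = 1 / 12" and divided_bernoulli_4: "\<B> 4 = - 1 / 120"
  by (simp_all add: divided_bernoulli_def bernoulli_2 bernoulli_4)

lemma divided_bernoulli_odd_eq_0: "odd n \<Longrightarrow> n \<ge> 3 \<Longrightarrow> \<B> n = 0"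
  by (simp add: divided_bernoulli_def bernoulli_odd_eq_0)

section \<open>Power sums modulo powers of p and p-integrality of Bernoulli numbers\<close>

definition power_sum :: "nat \<Rightarrow> nat \<Rightarrow> rat" where
  "power_sum p n = (\<Sum>a=1..p - 1. of_nat a ^ n)"

context prime_padic
begin

abbreviation S :: "nat \<Rightarrow> rat" where "S \<equiv> power_sum p"

lemma S_bernoulli:
  assumes "n > 0"
  shows "S n = (\<Sum>k\<le>n. of_nat (n choose k) * P ^ Suc k / of_nat (Suc k) * bernoulli (n - k))"
proof -
  have "{..<p} = insert 0 {1..p - 1}" using p_pos by auto
  then have "(\<Sum>a<p. (of_nat a :: rat) ^ n) = S n"
    using assms by (simp add: power_sum_def)
  then show ?thesis using sum_powers_bernoulli[of n p] by simp
qed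

text \<open>One factor p stays with each Bernoulli number, because p B_m is always p-integral while
  B_m need not be; the rest, p^k / (k + 1), is p-integral as well.\<close>

lemma S_bernoulli':
  assumes "n > 0"
  shows "S n = P * bernoulli n +
    (\<Sum>k=1..n. of_nat (n choose k) * (P ^ k / of_nat (Suc k)) * (P * bernoulli (n - k)))"
proof -
  have "{..n} = insert 0 {1..n}" by auto
  then show ?thesis
    by (subst S_bernoulli[OF assms]) (auto simp: field_simps intro!: sum.cong)
qed

lemma power_sum_I: "S n \<in> I 0"
  unfolding power_sum_def by (intro I_sum I_power_0) auto

lemma Suc_less_p_power: "Suc k < p ^ Suc k"
proof -
  have "Suc k < 2 ^ Suc k" by (rule less_exp)
  also have "\<dots> \<le> p ^ Suc k" using prime_p by (intro power_mono) (auto dest: prime_ge_2_nat)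
  finally show ?thesis .
qed

text \<open>A weak form of von Staudt-Clausen, obtained by solving the power-sum formula for its
  leading term p B_n.\<close>

lemma P_bernoulli_I: "P * bernoulli n \<in> I 0"
proof (induction n rule: less_induct)
  case (less n)
  show ?case
  proof (cases "n = 0")
    case True
    then show ?thesis by (simp add: bernoulli_0)
  next
    case False
    have "of_nat (n choose k) * (P ^ k / of_nat (Suc k)) * (P * bernoulli (n - k)) \<in> I 0"
      if "k \<in> {1..n}" for k
      using that Suc_less_p_power[of k] False
      by (intro I_mult_left[of _ _ 0] less.IH p_power_div_I) auto
    then have "S n - (\<Sum>k=1..n. of_nat (n choose k) * (P ^ k / of_nat (Suc k)) * (P * bernoulli (n - k))) \<in> I 0"
      by (intro I_diff power_sum_I I_sum)
    then show ?thesis using S_bernoulli'[of n] False by simp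
  qed
qed

text \<open>In this range all denominators k + 1 <= n + 1 < p of the recurrence are units.\<close>

lemma bernoulli_I:
  "n + 2 \<le> p \<Longrightarrow> bernoulli n \<in> I 0"
proof (induction n rule: less_induct)
  case (less n)
  show ?case
  proof (cases "n = 0")
    case True
    then show ?thesis by (simp add: bernoulli_0)
  next
    case False
    have "of_nat (n choose k) / of_nat (Suc k) * bernoulli (n - k) \<in> I 0" if "k \<in> {1..n}" for k
      using that less.prems False
      by (intro I_mult_left[of _ _ 0] less.IH I_div_unit) (auto dest: dvd_imp_le)
    then show ?thesis
      using False by (subst bernoulli_rec) (auto intro!: I_sum simp del: of_nat_Suc)
  qed
qed

lemma divided_bernoulli_I:
  assumes "n + 2 \<le> p" shows "\<B> n \<in> I 0"
proof (cases "n = 0")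
  case False
  then have "\<not> p dvd n" using assms by (auto dest: dvd_imp_le)
  then show ?thesis
    unfolding divided_bernoulli_def using assms by (intro I_div_unit bernoulli_I)
qed (simp add: divided_bernoulli_def)

lemma power_sum_small:
  assumes "n > 0" "n + 2 \<le> p"
  shows "S n - P * bernoulli n \<in> I 2"
proof -
  have "of_nat (n choose k) * (P ^ k / of_nat (Suc k)) * (P * bernoulli (n - k)) \<in> I 2"
    if k: "k \<in> {1..n}" for k
  proof -
    have "P ^ k / of_nat (Suc k) \<in> I k"
      using k assms by (intro I_div_unit) (auto dest: dvd_imp_le)
    moreover have "P * bernoulli (n - k) \<in> I 1"
      using k assms by (intro I_mult_right bernoulli_I) auto
    ultimately have "(P ^ k / of_nat (Suc k)) * (P * bernoulli (n - k)) \<in> I 2"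
      by (rule I_mult_ge) (use k in auto)
    then show ?thesis unfolding mult.assoc by (rule I_mult_left[OF of_nat_I])
  qed
  then have "(\<Sum>k=1..n. of_nat (n choose k) * (P ^ k / of_nat (Suc k)) * (P * bernoulli (n - k))) \<in> I 2"
    by (rule I_sum)
  then show ?thesis
    unfolding S_bernoulli'[OF assms(1)] by (simp only: add_diff_cancel_left')
qed

lemma power_sum_small_I1:
  assumes "n > 0" "n + 2 \<le> p"
  shows "S n \<in> I 1"
proof -
  have "P * bernoulli n \<in> I 1" using assms by (intro I_mult_right bernoulli_I) auto
  then show ?thesis
    using I_antimono[OF power_sum_small[OF assms], of 1] by (auto intro: I_cong)
qed

lemma power_sum_odd_I2:
  assumes "odd n" "n \<ge> 3" "n + 2 \<le> p"
  shows "S n \<in> I 2"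
  using power_sum_small[of n] assms bernoulli_odd_eq_0[of n] by (cases n) auto

end

locale large_prime = prime_padic +
  assumes p_ge: "p \<ge> 11"
begin

text \<open>Here n may exceed p, so two powers of p must come from p^k / (k + 1). This works for k
  >= 2; the term k = 1 contains an odd-index Bernoulli number and vanishes.\<close>

lemma power_sum_even:
  assumes "even n" "n \<ge> 4"
  shows "S n - P * bernoulli n \<in> I 2"
proof -
  have "of_nat (n choose k) * (P ^ k / of_nat (Suc k)) * (P * bernoulli (n - k)) \<in> I 2"
    if k: "k \<in> {1..n}" for k
  proof (cases "k = 1")
    case True
    then show ?thesis using assms by (simp add: bernoulli_odd_eq_0)
  next
    case False
    then obtain j where j: "k = j + 2" using k that[of "k - 2"] by auto
    have "j + 3 < p ^ Suc j"
    proof (induction j)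
      case (Suc j)
      have "Suc j + 3 < 2 * p ^ Suc j" using Suc by linarith
      also have "\<dots> \<le> p * p ^ Suc j" using p_ge by (intro mult_right_mono) auto
      finally show ?case by simp
    qed (use p_ge in simp)
    then have "P ^ j / of_nat (j + 3) \<in> I 0" by (intro p_power_div_I) auto
    then have "P ^ 2 * (P ^ j / of_nat (j + 3)) \<in> I 2" by (intro I_mult_right) auto
    also have "P ^ 2 * (P ^ j / of_nat (j + 3)) = P ^ k / of_nat (Suc k)"
      unfolding j by (simp add: power_add numeral_eq_Suc)
    finally show ?thesis by (intro I_mult_right I_mult_left P_bernoulli_I) auto
  qed
  then have "(\<Sum>k=1..n. of_nat (n choose k) * (P ^ k / of_nat (Suc k)) * (P * bernoulli (n - k))) \<in> I 2"
    by (rule I_sum)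
  moreover have "n > 0" using assms by simp
  ultimately show ?thesis
    by (simp only: S_bernoulli' add_diff_cancel_left')
qed

text \<open>The divisor n may be a multiple of p, so it is absorbed by (n choose k) / n = ((n - 1)
  choose (k - 1)) / k. Terms k = 1 and k = 3 vanish by parity, k = 2 gives the correction, and for k
  >= 4 the factor p^k / (k (k + 1)) is divisible by p^4.\<close>

lemma divided_power_sum_even:
  assumes "even n" "n \<ge> 6"
  shows "S n / of_nat n - (P * \<B> n + P ^ 3 * of_nat (n - 1) / 6 * bernoulli (n - 2)) \<in> I 4"
proof -
  define t where "t k = of_nat (n choose k) * (P ^ k / of_nat (Suc k)) * (P * bernoulli (n - k)) / of_nat n" for k
  have t_alt: "t k = of_nat ((n - 1) choose (k - 1)) * (P ^ k / of_nat (k * Suc k)) * (P * bernoulli (n - k))"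
    if "k \<in> {1..n}" for k
  proof -
    have "k * (n choose k) = n * ((n - 1) choose (k - 1))"
      using that by (intro times_binomial_minus1_eq) auto
    then have "(of_nat k * of_nat (n choose k) :: rat) = of_nat n * of_nat ((n - 1) choose (k - 1))"
      by (metis of_nat_mult)
    then have "(of_nat (n choose k) :: rat) = of_nat n * of_nat ((n - 1) choose (k - 1)) / of_nat k"
      using that by (simp add: field_simps)
    then show ?thesis using assms(2) unfolding t_def by (simp add: distrib_left)
  qed
  have "{1..n} = {1, 2, 3} \<union> {4..n}" using assms by auto
  then have "(\<Sum>k=1..n. t k) = (\<Sum>k\<in>{1,2,3}. t k) + (\<Sum>k=4..n. t k)"
    by (simp only:) (rule sum.union_disjoint, auto)
  also have "(\<Sum>k\<in>{1,2,3}. t k) = P ^ 3 * of_nat (n - 1) / 6 * bernoulli (n - 2)"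
  proof -
    have "t 1 = 0" "t 3 = 0"
      using assms by (simp_all add: t_def bernoulli_odd_eq_0)
    moreover have "t 2 = P ^ 3 * of_nat (n - 1) / 6 * bernoulli (n - 2)"
      using assms by (subst t_alt) (simp_all add: power2_eq_square power3_eq_cube)
    ultimately show ?thesis by simp
  qed
  finally have "(\<Sum>k=1..n. t k) = P ^ 3 * of_nat (n - 1) / 6 * bernoulli (n - 2) + (\<Sum>k=4..n. t k)" .
  moreover have "(\<Sum>k=1..n. t k) = S n / of_nat n - P * \<B> n"
    using assms S_bernoulli'[of n] unfolding t_def
    by (simp add: add_divide_distrib divided_bernoulli_def sum_divide_distrib)
  ultimately have e: "S n / of_nat n - (P * \<B> n + P ^ 3 * of_nat (n - 1) / 6 * bernoulli (n - 2)) =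
    (\<Sum>k=4..n. t k)"
    by linarith
  show ?thesis unfolding e
  proof (rule I_sum)
    fix k assume k: "k \<in> {4..n}"
    then obtain j where j: "k = j + 4" by (metis add.commute atLeastAtMost_iff le_Suc_ex)
    have "P ^ j / of_nat (k * Suc k) \<in> I 0"
    \<comment> \<open>For k = 4 the size estimate would ask for 20 < p, which fails for small p;
      coprimality of p to 20 replaces it. From k = 5 on, the estimate k (k + 1) < p^(k - 3)
      holds.\<close>
    proof (cases "j = 0")
      case True
      have "\<not> p dvd 20"
      proof
        assume "p dvd 20"
        then have "p dvd 4 * 5" by simp
        then have "p dvd 4 \<or> p dvd 5" using prime_p prime_dvd_multD by blast
        then show False using p_ge by (auto dest: dvd_imp_le)
      qed
      then show ?thesis using inverse_unit_I[of 20] True j by simp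
    next
      case False
      then obtain i where i: "j = Suc i" by (cases j) auto
      have "(i + 5) * (i + 6) < p ^ Suc (Suc i)"
      proof (induction i)
        case 0
        have "11 * 11 \<le> p * p" using p_ge by (intro mult_mono) auto
        then show ?case by simp
      next
        case (Suc i)
        have "(Suc i + 5) * (Suc i + 6) \<le> 2 * ((i + 5) * (i + 6))" by (simp add: algebra_simps)
        also have "\<dots> < 2 * p ^ Suc (Suc i)" using Suc by simp
        also have "\<dots> \<le> p * p ^ Suc (Suc i)" using p_ge by (intro mult_right_mono) auto
        finally show ?case by simp
      qed
      then show ?thesis unfolding j i by (intro p_power_div_I) (auto simp: algebra_simps)
    qed
    then have "P ^ 4 * (P ^ j / of_nat (k * Suc k)) \<in> I 4" by (intro I_mult_right) auto
    also have "P ^ 4 * (P ^ j / of_nat (k * Suc k)) = P ^ k / of_nat (k * Suc k)"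
      unfolding j by (simp add: power_add mult.commute)
    finally have *: "P ^ k / of_nat (k * Suc k) \<in> I 4" .
    have "k \<in> {1..n}" using k by simp
    then show "t k \<in> I 4"
      by (simp only: t_alt I_mult_right[OF I_mult_left[OF of_nat_I *] P_bernoulli_I])
  qed
qed

end

subsection \<open>Logarithms of power series\<close>

context prime_padic
begin

definition fps_ideal :: "nat \<Rightarrow> rat fps set" where
  "fps_ideal k = {f. \<forall>n. fps_nth f n \<in> I k}"

lemma fps_ideal_nth: "f \<in> fps_ideal k \<Longrightarrow> fps_nth f n \<in> I k"
  by (simp add: fps_ideal_def)

lemma fps_ideal_mult: "f \<in> fps_ideal k \<Longrightarrow> g \<in> fps_ideal l \<Longrightarrow> f * g \<in> fps_ideal (k + l)"
  by (auto simp: fps_ideal_def fps_mult_nth intro!: I_sum I_mult)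

lemma fps_ideal_power: "f \<in> fps_ideal 1 \<Longrightarrow> f ^ k \<in> fps_ideal k"
proof (induction k)
  case 0
  then show ?case by (auto simp: fps_ideal_def)
next
  case (Suc k)
  then show ?case using fps_ideal_mult[of f 1 "f ^ k" k] by simp
qed

end

text \<open>Each factor has logarithmic derivative c / (1 + c X), a geometric series, and these add
  up over the product.\<close>

lemma fps_deriv_prod_linear:
  fixes c :: "'a \<Rightarrow> rat"
  assumes "finite A"
  shows "fps_deriv (\<Prod>a\<in>A. 1 + fps_const (c a) * fps_X) =
    (\<Prod>a\<in>A. 1 + fps_const (c a) * fps_X) * Abs_fps (\<lambda>n. (-1) ^ n * (\<Sum>a\<in>A. c a ^ Suc n))"
  using assms
proof (induction A)
  case empty
  have "Abs_fps (\<lambda>n. 0 :: rat) = 0" by (rule fps_ext) simp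
  then show ?case by simp
next
  case (insert b A)
  let ?l = "1 + fps_const (c b) * fps_X" and ?g = "Abs_fps (\<lambda>n. (-1) ^ n * c b ^ Suc n)"
  have lg: "?l * ?g = fps_const (c b)"
  proof (rule fps_ext)
    fix n show "fps_nth (?l * ?g) n = fps_nth (fps_const (c b)) n"
      by (cases n) (simp_all add: distrib_right mult.assoc)
  qed
  have split: "Abs_fps (\<lambda>n. (-1) ^ n * (\<Sum>a\<in>insert b A. c a ^ Suc n)) =
     ?g + Abs_fps (\<lambda>n. (-1) ^ n * (\<Sum>a\<in>A. c a ^ Suc n))"
    using insert.hyps by (intro fps_ext) (simp add: distrib_left)
  have "fps_deriv (?l * (\<Prod>a\<in>A. 1 + fps_const (c a) * fps_X)) =
    fps_const (c b) * (\<Prod>a\<in>A. 1 + fps_const (c a) * fps_X) +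
    ?l * ((\<Prod>a\<in>A. 1 + fps_const (c a) * fps_X) * Abs_fps (\<lambda>n. (-1) ^ n * (\<Sum>a\<in>A. c a ^ Suc n)))"
    using insert.IH by (simp add: algebra_simps)
  also have "fps_const (c b) * (\<Prod>a\<in>A. 1 + fps_const (c a) * fps_X) =
    ?l * (\<Prod>a\<in>A. 1 + fps_const (c a) * fps_X) * ?g"
    proof -
    have "fps_const (c b) * (\<Prod>a\<in>A. 1 + fps_const (c a) * fps_X) = (?l * ?g) * (\<Prod>a\<in>A. 1 + fps_const (c a) * fps_X)"
      by (simp only: lg)
    then show ?thesis by (simp only: mult_ac)
  qed
  also have "?l * (\<Prod>a\<in>A. 1 + fps_const (c a) * fps_X) * ?g +
    ?l * ((\<Prod>a\<in>A. 1 + fps_const (c a) * fps_X) * Abs_fps (\<lambda>n. (-1) ^ n * (\<Sum>a\<in>A. c a ^ Suc n))) =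
    ?l * (\<Prod>a\<in>A. 1 + fps_const (c a) * fps_X) *
     (?g + Abs_fps (\<lambda>n. (-1) ^ n * (\<Sum>a\<in>A. c a ^ Suc n)))"
    by (simp only: distrib_left mult.assoc)
  finally show ?case
    by (simp only: split prod.insert[OF insert.hyps])
qed

text \<open>Serves to replace a power of 1 / (1 - v X^(p-1)) by a partial sum of its expansion: the
  error only affects orders from N on.\<close>

lemma fps_nth_eq_of_mult_one_plus:
  fixes f g h :: "rat fps"
  assumes "f * (1 + fps_X ^ N * h) = g" "n < N"
  shows "fps_nth f n = fps_nth g n"
proof -
  have "g = f + fps_X ^ N * (f * h)" using assms(1) by (simp add: algebra_simps)
  then show ?thesis using assms(2) by (simp add: fps_X_power_mult_nth)
qed

lemma fps_deriv_power_nth: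
  fixes d :: "rat fps"
  assumes "n > 0"
  shows "fps_nth (d ^ k * fps_deriv d) (n - 1) = of_nat n * fps_nth (d ^ Suc k) n / of_nat (Suc k)"
proof -
  have "fps_nth (fps_deriv (d ^ Suc k)) (n - 1) = of_nat n * fps_nth (d ^ Suc k) n"
    using assms by (simp add: fps_deriv_nth del: power_Suc fps_deriv_mult)
  moreover have "fps_deriv (d ^ Suc k) = fps_const (of_nat (Suc k)) * (d ^ k * fps_deriv d)"
    by (subst fps_deriv_power) (simp add: mult_ac)
  ultimately have "of_nat n * fps_nth (d ^ Suc k) n = of_nat (Suc k) * fps_nth (d ^ k * fps_deriv d) (n - 1)"
    by (simp only: fps_mult_left_const_nth)
  then show ?thesis by (simp only: nonzero_mult_div_cancel_left of_nat_neq_0 not_False_eq_True)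
qed

text \<open>
  The logarithmic derivative of \<open>u * (1 + d)\<close> is that of \<open>u\<close> plus the derivative of
  \<open>ln (1 + d) = d - d\<^sup>2 / 2 + \<dots>\<close>, of which only finitely many terms matter for a coefficient.
\<close>

lemma log_deriv_nth:
  fixes u d f Q :: "rat fps"
  assumes f: "f = u * (1 + d)" and Q: "fps_deriv f = f * Q"
    and u0: "fps_nth u 0 = 1" and d0: "fps_nth d 0 = 0" and n: "0 < n" "n \<le> N"
  shows "fps_nth Q (n - 1) = fps_nth (fps_deriv u * inverse u) (n - 1) +
    of_nat n * (\<Sum>k<N. (-1) ^ k * fps_nth (d ^ Suc k) n / of_nat (Suc k))"
proof -
  define U where "U = fps_deriv u * inverse u"
  \<comment> \<open>\<open>G\<close> is the truncated geometric series for 1 / (1 + d). Its error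
    (-d)^N is divisible by X^N, as d has no constant term, and so is invisible at index n - 1 <
    N.\<close>
  define G where "G = (\<Sum>k<N. (- d) ^ k)"
  have f0: "fps_nth f 0 = 1" using f u0 d0 by simp
  have uU: "u * U = fps_deriv u"
    using u0 inverse_mult_eq_1'[of u] by (simp add: U_def mult.left_commute)
  have G: "(1 + d) * G = 1 - (- d) ^ N"
    unfolding G_def using one_diff_power_eq[of "- d" N] by simp
  have "f * (Q - U - G * fps_deriv d) = fps_deriv f - (u * U) * (1 + d) - u * ((1 + d) * G) * fps_deriv d"
    using Q f by (simp add: algebra_simps)
  also have "\<dots> = u * fps_deriv d * (- d) ^ N"
    unfolding uU G by (simp add: f algebra_simps)
  finally have "inverse f * (f * (Q - U - G * fps_deriv d)) = inverse f * (u * fps_deriv d * (- d) ^ N)"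
    by simp
  then have R: "Q - U - G * fps_deriv d = inverse f * (u * fps_deriv d * (- d) ^ N)"
    using inverse_mult_eq_1[of f] f0 by (simp add: mult.assoc[symmetric])
  have "- d = fps_X * fps_shift 1 (- d)"
    using d0 by (intro fps_ext) simp
  then have "(- d) ^ N = fps_X ^ N * fps_shift 1 (- d) ^ N"
    by (metis power_mult_distrib)
  then have "Q - U - G * fps_deriv d = fps_X ^ N * (inverse f * (u * fps_deriv d * fps_shift 1 (- d) ^ N))"
    unfolding R by (simp add: mult_ac)
  then have "fps_nth (Q - U - G * fps_deriv d) (n - 1) = 0"
    using n by (simp only: fps_X_power_mult_nth) simp
  then have "fps_nth Q (n - 1) = fps_nth U (n - 1) + fps_nth (G * fps_deriv d) (n - 1)"
    by simp
  also have "fps_nth (G * fps_deriv d) (n - 1) =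
      (\<Sum>k<N. fps_nth ((- d) ^ k * fps_deriv d) (n - 1))"
    by (simp add: G_def sum_distrib_right fps_sum_nth)
  also have "\<dots> = (\<Sum>k<N. of_nat n * ((-1) ^ k * fps_nth (d ^ Suc k) n / of_nat (Suc k)))"
  proof (rule sum.cong[OF refl])
    fix k
    have "(- d) ^ k = fps_const ((-1) ^ k) * d ^ k"
      by (subst power_minus) (simp flip: fps_const_power fps_const_neg)
    then have "fps_nth ((- d) ^ k * fps_deriv d) (n - 1) = (-1) ^ k * fps_nth (d ^ k * fps_deriv d) (n - 1)"
      by (simp only: mult.assoc fps_mult_left_const_nth)
    then show "fps_nth ((- d) ^ k * fps_deriv d) (n - 1) =
       of_nat n * ((-1) ^ k * fps_nth (d ^ Suc k) n / of_nat (Suc k))"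
      unfolding fps_deriv_power_nth[OF n(1)] by simp
  qed
  finally show ?thesis by (simp add: U_def sum_distrib_left)
qed

text \<open>With \<open>U\<close> the logarithmic derivative, u U = u' reads U = v X^q U - q v
  X^(q-1), a recursion of step q on coefficients that starts at index q - 1.\<close>

lemma log_deriv_one_minus_power_nth:
  fixes v :: rat
  assumes q: "q > 0" and n: "n > 0"
  defines "u \<equiv> 1 - fps_const v * fps_X ^ q"
  shows "fps_nth (fps_deriv u * inverse u) (n - 1) =
    (if q dvd n then - (of_nat q * v ^ (n div q)) else 0)"
  using n
proof (induction n rule: less_induct)
  case (less n)
  define U where "U = fps_deriv u * inverse u"
  have u0: "fps_nth u 0 = 1" using q by (simp add: u_def)
  have uU: "u * U = fps_deriv u"
    using u0 inverse_mult_eq_1'[of u] by (simp add: U_def mult.left_commute)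
  have "fps_deriv u = - (fps_const (of_nat q * v) * fps_X ^ (q - 1))"
    using q by (simp add: u_def fps_deriv_power mult_ac)
  then have "U = fps_const v * (fps_X ^ q * U) - fps_const (of_nat q * v) * fps_X ^ (q - 1)"
    using uU by (simp add: u_def algebra_simps)
  then have "fps_nth U (n - 1) = fps_nth (fps_const v * (fps_X ^ q * U) - fps_const (of_nat q * v) * fps_X ^ (q - 1)) (n - 1)"
    by (rule arg_cong)
  then have rec: "fps_nth U (n - 1) = (if n - 1 < q then 0 else v * fps_nth U (n - 1 - q)) -
     (if n = q then of_nat q * v else 0)"
    using q less.prems by (auto simp: fps_X_power_mult_nth fps_X_power_nth)
  show ?case
  proof (cases "n \<le> q")
    case True
    then have "q dvd n \<longleftrightarrow> n = q" using less.prems by (auto dest: dvd_imp_le)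
    then show ?thesis using rec True less.prems q unfolding U_def by auto
  next
    case False
    then have "fps_nth U (n - 1) = v * fps_nth U (n - q - 1)"
      using rec by (simp add: diff_right_commute)
    also have "\<dots> = v * (if q dvd n - q then - (of_nat q * v ^ ((n - q) div q)) else 0)"
      using less.IH[of "n - q"] False q unfolding U_def by simp
    also have "\<dots> = (if q dvd n then - (of_nat q * v ^ (n div q)) else 0)"
    proof -
      have "q dvd n - q \<longleftrightarrow> q dvd n" using False by (simp add: dvd_minus_self)
      moreover have "n div q = Suc ((n - q) div q)" using False q by (simp add: le_div_geq)
      ultimately show ?thesis by simp
    qed
    finally show ?thesis unfolding U_def .
  qed
qed

lemma prod_linear_nth:
  fixes c :: "'a \<Rightarrow> rat"
  assumes "finite A"
  shows "fps_nth (\<Prod>a\<in>A. 1 + fps_const (c a) * fps_X) k = (\<Sum>J | J \<subseteq> A \<and> card J = k. \<Prod>a\<in>J. c a)"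
proof -
  have "(\<Prod>a\<in>A. 1 + fps_const (c a) * fps_X) = (\<Prod>a\<in>A. fps_const (c a) * fps_X + 1)"
    by (simp add: add.commute)
  also have "\<dots> = (\<Sum>J\<in>Pow A. \<Prod>a\<in>J. fps_const (c a) * fps_X)"
    using prod_add[OF assms, of "\<lambda>a. fps_const (c a) * fps_X" "\<lambda>_. 1"] by simp
  also have "\<dots> = (\<Sum>J\<in>Pow A. fps_const (\<Prod>a\<in>J. c a) * fps_X ^ card J)"
  proof (rule sum.cong[OF refl])
    fix J
    have "(\<Prod>a\<in>J. fps_const (c a)) = fps_const (\<Prod>a\<in>J. c a)"
      by (induction J rule: infinite_finite_induct) auto
    then show "(\<Prod>a\<in>J. fps_const (c a) * fps_X) = fps_const (\<Prod>a\<in>J. c a) * fps_X ^ card J"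
      by (simp add: prod.distrib)
  qed
  finally have "fps_nth (\<Prod>a\<in>A. 1 + fps_const (c a) * fps_X) k =
     (\<Sum>J\<in>Pow A. if card J = k then \<Prod>a\<in>J. c a else 0)"
    by (simp add: fps_sum_nth fps_X_power_nth if_distrib cong: if_cong) (intro sum.cong, auto)
  also have "\<dots> = (\<Sum>J | J \<subseteq> A \<and> card J = k. \<Prod>a\<in>J. c a)"
    using assms by (intro sum.mono_neutral_cong_right) auto
  finally show ?thesis .
qed

section \<open>Elementary symmetric functions of 1, ..., p - 1\<close>

context prime_padic
begin

definition esf_fps :: "rat fps" where
  "esf_fps = (\<Prod>a\<in>{1..p - 1}. 1 + fps_const (of_nat a) * fps_X)"

text \<open>The sign makes v congruent to 1 modulo p by Wilson's theorem, and lets 1 - v X^(p-1)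
  carry the constant and the top coefficient of the product.\<close>

definition v :: rat where "v = - fact (p - 1)"

abbreviation e :: "nat \<Rightarrow> rat" where "e \<equiv> fps_nth esf_fps"

definition eps :: "rat fps" where
  "eps = Abs_fps (\<lambda>n. if 1 \<le> n \<and> n \<le> p - 2 then e n else 0)"

definition u :: "rat fps" where "u = 1 - fps_const v * fps_X ^ (p - 1)"

definition dl :: "rat fps" where "dl = eps * inverse u"

lemma e_eq: "e n = (\<Sum>J | J \<subseteq> {1..p - 1} \<and> card J = n. \<Prod>a\<in>J. of_nat a)"
  unfolding esf_fps_def by (rule prod_linear_nth) simp

lemma e_0: "e 0 = 1"
proof -
  have "{J. J \<subseteq> {1..p - 1} \<and> card J = 0} = {{}}" by (auto dest: finite_subset)
  then show ?thesis by (simp add: e_eq)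
qed

lemma e_ge:
  assumes "n \<ge> p" shows "e n = 0"
proof -
  have "card J \<noteq> n" if "J \<subseteq> {1..p - 1}" for J
    using card_mono[OF _ that] assms p_pos by simp
  then have "{J. J \<subseteq> {1..p - 1} \<and> card J = n} = {}" by blast
  then show "e n = 0" by (simp only: e_eq sum.empty)
qed

lemma e_last: "e (p - 1) = fact (p - 1)"
proof -
  have "{J. J \<subseteq> {1..p - 1} \<and> card J = p - 1} = {{1..p - 1}}"
    using card_subset_eq[of "{1..p - 1}"] by auto
  then show ?thesis by (simp only: e_eq fact_prod) simp
qed

lemma e_I: "e n \<in> I 0"
proof -
  have "(\<Prod>a\<in>A. 1 + fps_const (of_nat a) * fps_X) \<in> fps_ideal 0" if "finite A" for A
    using that
  proof (induction A)
    case empty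
    then show ?case by (auto simp: fps_ideal_def)
  next
    case (insert b A)
    have "1 + fps_const (of_nat b) * fps_X \<in> fps_ideal 0"
      by (auto simp: fps_ideal_def fps_X_def)
    then show ?case using insert fps_ideal_mult[of _ 0 _ 0] by simp
  qed
  then show ?thesis unfolding esf_fps_def fps_ideal_def by blast
qed

lemma v_I: "v \<in> I 0"
  unfolding v_def using of_nat_I[of "fact (p - 1)"] by simp

lemma deriv_esf_fps: "fps_deriv esf_fps = esf_fps * Abs_fps (\<lambda>n. (-1) ^ n * S (Suc n))"
  unfolding esf_fps_def power_sum_def by (rule fps_deriv_prod_linear) simp

text \<open>Newton's identities, read off coefficientwise from the logarithmic derivative.\<close>

lemma newton: "of_nat (Suc n) * e (Suc n) = (\<Sum>i=0..n. e i * ((-1) ^ (n - i) * S (Suc n - i)))"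
proof -
  have "fps_nth (fps_deriv esf_fps) n = (\<Sum>i=0..n. e i * ((-1) ^ (n - i) * S (Suc (n - i))))"
    unfolding deriv_esf_fps by (simp add: fps_mult_nth)
  then show ?thesis by (simp add: Suc_diff_le)
qed

lemma e_1: "e 1 = S 1"
  using newton[of 0] by (simp add: e_0)

lemma e_2: "e 2 = ((S 1)\<^sup>2 - S 2) / 2"
  using newton[of 1] e_1 by (simp add: e_0 numeral_2_eq_2 power2_eq_square)

lemma S_2: "S 2 = (2 * P ^ 3 - 3 * P ^ 2 + P) / 6"
proof -
  have "{..2::nat} = {0, 1, 2}" by auto
  then show ?thesis
    using S_bernoulli[of 2] by (simp add: bernoulli_0 bernoulli_1[unfolded One_nat_def] bernoulli_2 field_simps power2_eq_square power3_eq_cube)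
qed

text \<open>Every power sum in Newton's identity has index between 1 and p - 2, hence is divisible
  by p, and the factor n on the left is a unit.\<close>

lemma e_I1:
  assumes "0 < n" "n + 2 \<le> p"
  shows "e n \<in> I 1"
proof -
  obtain m where m: "n = Suc m" using assms by (cases n) auto
  have "of_nat n * e n \<in> I 1"
    unfolding m newton using assms m
    by (intro I_sum I_mult_left[OF e_I] I_mult_left[of "(-1) ^ _"] power_sum_small_I1) (auto intro!: I_power_0)
  moreover have "\<not> p dvd n" using assms by (auto dest: dvd_imp_le)
  ultimately have "of_nat n * e n / of_nat n \<in> I 1" by (rule I_div_unit)
  then show ?thesis using assms by simp
qed

text \<open>In Newton's identity the term i = 0 is a power sum of odd index at least 3, divisible by
  p^2; all others are products of two multiples of p.\<close>

lemma e_odd_I2: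
  assumes "odd n" "3 \<le> n" "n + 2 \<le> p"
  shows "e n \<in> I 2"
proof -
  obtain m where m: "n = Suc m" using assms by (cases n) auto
  have "e i * ((-1) ^ (m - i) * S (Suc m - i)) \<in> I 2" if "i \<in> {0..m}" for i
  proof (cases "i = 0")
    case True
    then show ?thesis using assms m power_sum_odd_I2[of n]
      by (simp add: e_0)
  next
    case False
    then have "(-1) ^ (m - i) * S (Suc m - i) \<in> I 1"
      using that assms m by (intro I_mult_left power_sum_small_I1) (auto intro!: I_power_0)
    moreover have "e i \<in> I 1"
      using False that assms m by (intro e_I1) auto
    ultimately show ?thesis
      using I_mult_ge[of "e i" 1 _ 1 2] by simp
  qed
  then have "of_nat n * e n \<in> I 2"
    unfolding m newton by (intro I_sum)
  moreover have "\<not> p dvd n" using assms by (auto dest: dvd_imp_le)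
  ultimately have "of_nat n * e n / of_nat n \<in> I 2" by (rule I_div_unit)
  then show ?thesis using assms by simp
qed

end

section \<open>The logarithm of the factored product modulo p^4\<close>

context large_prime
begin

lemma u_0: "fps_nth u 0 = 1"
  using p_ge by (simp add: u_def)

lemma u_dl: "u * dl = eps"
  using u_0 inverse_mult_eq_1'[of u] by (simp add: dl_def mult.left_commute)

lemma esf_fps_factor: "esf_fps = u * (1 + dl)"
proof -
  have "esf_fps = u + eps"
  proof (rule fps_ext)
    fix n
    consider "n = 0" | "1 \<le> n" "n \<le> p - 2" | "n = p - 1" | "n \<ge> p" by linarith
    then show "e n = fps_nth (u + eps) n"
      by cases (use p_ge in \<open>auto simp: u_def eps_def v_def e_0 e_last e_last[unfolded One_nat_def] e_ge fps_X_power_nth\<close>)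
  qed
  then show ?thesis by (simp add: distrib_left u_dl)
qed

lemma eps_I1: "eps \<in> fps_ideal 1"
  by (auto simp: fps_ideal_def eps_def intro!: e_I1[unfolded One_nat_def])

lemma dl_expand: "dl = eps + fps_const v * (fps_X ^ (p - 1) * dl)"
proof -
  have "dl - fps_const v * (fps_X ^ (p - 1) * dl) = eps"
    using u_dl by (simp add: u_def left_diff_distrib mult.assoc)
  then show ?thesis by (simp add: algebra_simps)
qed

lemma dl_nth_rec: "fps_nth dl n = fps_nth eps n + (if n < p - 1 then 0 else v * fps_nth dl (n - (p - 1)))"
  by (subst dl_expand) (auto simp: fps_X_power_mult_nth)

text \<open>As \<open>eps\<close> has degree below p - 1, the geometric expansion of 1 / u repeats
  its block of coefficients with period p - 1, multiplied by v each time.\<close>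

lemma dl_nth:
  assumes "m < p - 1"
  shows "fps_nth dl (m + k * (p - 1)) = v ^ k * fps_nth eps m"
proof (induction k)
  case 0
  then show ?case using assms dl_nth_rec[of m] by simp
next
  case (Suc k)
  have "fps_nth eps (m + Suc k * (p - 1)) = 0" using p_ge by (auto simp: eps_def)
  then show ?case using Suc dl_nth_rec[of "m + Suc k * (p - 1)"] by (simp add: add.commute add.left_commute)
qed

lemma dl_I1: "dl \<in> fps_ideal 1"
proof -
  have "fps_nth dl n \<in> I 1" for n
  proof -
    have "n = n mod (p - 1) + n div (p - 1) * (p - 1)" by (rule mod_div_mult_eq[symmetric])
    then have "fps_nth dl n = v ^ (n div (p - 1)) * fps_nth eps (n mod (p - 1))"
      using dl_nth[of "n mod (p - 1)" "n div (p - 1)"] p_ge by simp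
    also have "\<dots> \<in> I 1"
      by (intro I_mult_left I_power_0 v_I fps_ideal_nth eps_I1)
    finally show ?thesis .
  qed
  then show ?thesis by (simp add: fps_ideal_def)
qed

lemma dl_0: "fps_nth dl 0 = 0"
  using dl_nth[of 0 0] p_ge by (simp add: eps_def)

text \<open>The power of \<open>dl\<close> supplies p^(k+1) with k + 1 >= 4; the k - 3 powers beyond
  the fourth cancel any p in the denominator k + 1.\<close>

lemma log_remainder:
  assumes "k \<ge> 3"
  shows "fps_nth (dl ^ Suc k) n / of_nat (Suc k) \<in> I 4"
proof -
  obtain j where j: "k = j + 3" using assms by (metis add.commute le_Suc_ex)
  have x: "fps_nth (dl ^ Suc k) n \<in> I (4 + j)"
    using fps_ideal_nth[OF fps_ideal_power[OF dl_I1], of "Suc k" n] unfolding j by simp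
  define y where "y = fps_nth (dl ^ Suc k) n / P ^ j"
  have xy: "fps_nth (dl ^ Suc k) n = P ^ j * y" by (simp add: y_def)
  have y: "y \<in> I 4" using x unfolding xy by (simp only: P_power_mult_I_iff)
  have "j + 4 < p ^ Suc j"
  proof (induction j)
    case (Suc j)
    have "Suc j + 4 < 2 * p ^ Suc j" using Suc by linarith
    also have "\<dots> \<le> p * p ^ Suc j" using p_ge by (intro mult_right_mono) auto
    finally show ?case by simp
  qed (use p_ge in simp)
  then have "P ^ j / of_nat (j + 4) \<in> I 0" by (intro p_power_div_I) auto
  then have "P ^ j / of_nat (j + 4) * y \<in> I 4" using y by (rule I_mult_left)
  also have "P ^ j / of_nat (j + 4) * y = fps_nth (dl ^ Suc k) n / of_nat (Suc k)"
    unfolding xy by (simp add: j)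
  finally show ?thesis .
qed

lemma log_expansion:
  assumes "n > 0"
  shows "\<exists>r \<in> I 4. (-1) ^ (n - 1) * S n = (if p - 1 dvd n then - (of_nat (p - 1) * v ^ (n div (p - 1))) else 0) +
    of_nat n * (fps_nth dl n - fps_nth (dl ^ 2) n / 2 + fps_nth (dl ^ 3) n / 3 + r)"
proof -
  define t where "t k = (-1) ^ k * fps_nth (dl ^ Suc k) n / of_nat (Suc k)" for k
  \<comment> \<open>Truncating at n + 3 satisfies the bound n <= N and ensures that the first three
    terms are always present.\<close>
  have "{..<n + 3} = {0, 1, 2} \<union> {3..<n + 3}" by auto
  then have "(\<Sum>k<n + 3. t k) = (\<Sum>k\<in>{0,1,2}. t k) + (\<Sum>k=3..<n + 3. t k)"
    by (simp only:) (rule sum.union_disjoint, auto)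
  moreover have "(\<Sum>k\<in>{0,1,2}. t k) = fps_nth dl n - fps_nth (dl ^ 2) n / 2 + fps_nth (dl ^ 3) n / 3"
    by (simp add: t_def numeral_2_eq_2 numeral_3_eq_3)
  moreover have "(\<Sum>k=3..<n + 3. t k) \<in> I 4"
  proof (rule I_sum)
    fix k assume "k \<in> {3..<n + 3}"
    then have "(-1) ^ k * (fps_nth (dl ^ Suc k) n / of_nat (Suc k)) \<in> I 4"
      by (intro I_mult_left log_remainder) (auto intro!: I_power_0)
    then show "t k \<in> I 4" by (simp add: t_def)
  qed
  ultimately have sum: "\<exists>r \<in> I 4. (\<Sum>k<n + 3. t k) =
      fps_nth dl n - fps_nth (dl ^ 2) n / 2 + fps_nth (dl ^ 3) n / 3 + r"
    by auto
  have "(-1) ^ (n - 1) * S n = fps_nth (Abs_fps (\<lambda>n. (-1) ^ n * S (Suc n))) (n - 1)"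
    using assms by simp
  also have "\<dots> = fps_nth (fps_deriv u * inverse u) (n - 1) + of_nat n * (\<Sum>k<n + 3. t k)"
    unfolding t_def using assms
    by (intro log_deriv_nth[OF esf_fps_factor deriv_esf_fps u_0 dl_0]) auto
  also have "fps_nth (fps_deriv u * inverse u) (n - 1) =
     (if p - 1 dvd n then - (of_nat (p - 1) * v ^ (n div (p - 1))) else 0)"
    unfolding u_def using assms p_ge by (intro log_deriv_one_minus_power_nth) auto
  finally show ?thesis using sum by auto
qed

lemma log_even:
  assumes "even n" "n > 0" "\<not> p - 1 dvd n"
  shows "- (S n / of_nat n) - (fps_nth dl n - fps_nth (dl ^ 2) n / 2 + fps_nth (dl ^ 3) n / 3) \<in> I 4"
proof -
  have "odd (n - 1)" using assms by simp
  then obtain r where r: "r \<in> I 4" "- S n = of_nat n * (fps_nth dl n - fps_nth (dl ^ 2) n / 2 + fps_nth (dl ^ 3) n / 3 + r)"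
    using log_expansion[OF assms(2)] assms by auto
  then have "- (S n / of_nat n) = fps_nth dl n - fps_nth (dl ^ 2) n / 2 + fps_nth (dl ^ 3) n / 3 + r"
    using assms(2) by (simp add: field_simps)
  then show ?thesis using r(1) by simp
qed

lemma half_I: "x \<in> I k \<Longrightarrow> x / 2 \<in> I k" and third_I: "x \<in> I k \<Longrightarrow> x / 3 \<in> I k"
proof -
  have "\<not> p dvd 2" "\<not> p dvd 3" using p_ge by (auto dest: dvd_imp_le)
  then show "x \<in> I k \<Longrightarrow> x / 2 \<in> I k" "x \<in> I k \<Longrightarrow> x / 3 \<in> I k"
    using I_div_unit[of x k 2] I_div_unit[of x k 3] by auto
qed

lemma dl2_I: "fps_nth (dl ^ 2) n \<in> I 2" and dl3_I: "fps_nth (dl ^ 3) n \<in> I 3"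
  using fps_ideal_nth[OF fps_ideal_power[OF dl_I1]] by auto

lemma log_even_3:
  assumes "even n" "n > 0" "\<not> p - 1 dvd n"
  shows "- (S n / of_nat n) - (fps_nth dl n - fps_nth (dl ^ 2) n / 2) \<in> I 3"
proof -
  have "(fps_nth dl n - fps_nth (dl ^ 2) n / 2 + fps_nth (dl ^ 3) n / 3) - (fps_nth dl n - fps_nth (dl ^ 2) n / 2) \<in> I 3"
    using third_I[OF dl3_I[of n]] by simp
  then show ?thesis by (rule I_trans[OF I_antimono[OF log_even[OF assms]], rotated]) simp
qed

text \<open>The logarithm yields the quotient by n directly, so this covers multiples of p such as n
  = 2 p.\<close>

lemma divided_power_sum_I1:
  assumes "even n" "n > 0" "\<not> p - 1 dvd n"
  shows "S n / of_nat n \<in> I 1"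
proof -
  have "fps_nth dl n - fps_nth (dl ^ 2) n / 2 \<in> I 1"
    using fps_ideal_nth[OF dl_I1, of n] I_antimono[OF half_I[OF dl2_I[of n]], of 1]
    by (intro I_diff) auto
  then have "- (S n / of_nat n) \<in> I 1"
    by (rule I_cong[OF I_antimono[OF log_even_3[OF assms]], rotated]) simp
  then show ?thesis by simp
qed

text \<open>At a multiple of p - 1 the factor u contributes the main term, while the coefficient of
  \<open>dl\<close> is a multiple of the zero constant term of \<open>eps\<close>. The error
  therefore starts with the square of \<open>dl\<close>.\<close>

lemma power_sum_multiple:
  assumes "k > 0"
  shows "S (k * (p - 1)) - of_nat (p - 1) * v ^ k \<in> I 2"
proof -
  let ?n = "k * (p - 1)"
  have odd: "odd (?n - 1)" "?n > 0"
    using assms p_ge prime_odd_nat[OF prime_p] by auto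
  obtain r where r: "r \<in> I 4" "- S ?n = - (of_nat (p - 1) * v ^ k) +
    of_nat ?n * (fps_nth dl ?n - fps_nth (dl ^ 2) ?n / 2 + fps_nth (dl ^ 3) ?n / 3 + r)"
    using log_expansion[of ?n] odd p_ge by auto
  have "fps_nth dl ?n = 0"
    using dl_nth[of 0 k] p_ge by (simp add: eps_def)
  then have R: "of_nat ?n * (fps_nth dl ?n - fps_nth (dl ^ 2) ?n / 2 + fps_nth (dl ^ 3) ?n / 3 + r) \<in> I 2"
    by (intro I_mult_left[OF of_nat_I] I_add I_diff half_I dl2_I I_antimono[OF r(1)]
        I_antimono[OF third_I[OF dl3_I]]) auto
  have "S ?n - of_nat (p - 1) * v ^ k =
    - (of_nat ?n * (fps_nth dl ?n - fps_nth (dl ^ 2) ?n / 2 + fps_nth (dl ^ 3) ?n / 3 + r))"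
    using r(2) by linarith
  then show ?thesis using R by (simp only: I_minus_iff)
qed

text \<open>The numbers 1, 2, 3 are the first coefficients of 1 / (1 - y)^2, taken at y = v X^(p-1);
  the cube below uses 1, 3, 6 from 1 / (1 - y)^3. Multiplying the partial sum back leaves 1 plus a
  multiple of y^3.\<close>

lemma dl2_expand:
  assumes "n < 3 * (p - 1)"
  shows "fps_nth (dl ^ 2) n = fps_nth (eps ^ 2) n + (if n < p - 1 then 0 else 2 * v * fps_nth (eps ^ 2) (n - (p - 1)))
    + (if n < 2 * (p - 1) then 0 else 3 * v ^ 2 * fps_nth (eps ^ 2) (n - 2 * (p - 1)))"
proof -
  define c x where "c = fps_const v" and "x = (fps_X ^ (p - 1) :: rat fps)"
  have X: "x ^ 2 = fps_X ^ (2 * (p - 1))" "x ^ 3 = fps_X ^ (3 * (p - 1))"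
    unfolding x_def by (simp_all add: power_mult[symmetric] mult.commute)
  have u: "u = 1 - c * x" by (simp add: u_def c_def x_def)
  have "(1 - c * x) ^ 2 * (1 + 2 * c * x + 3 * c ^ 2 * x ^ 2) = 1 + x ^ 3 * (3 * c ^ 4 * x - 4 * c ^ 3)"
    by (simp add: algebra_simps eval_nat_numeral)
  then have "dl ^ 2 * (1 + x ^ 3 * (3 * c ^ 4 * x - 4 * c ^ 3)) = (u * dl) ^ 2 * (1 + 2 * c * x + 3 * c ^ 2 * x ^ 2)"
    unfolding u by (simp add: power_mult_distrib mult_ac)
  then have "fps_nth (dl ^ 2) n = fps_nth ((u * dl) ^ 2 * (1 + 2 * c * x + 3 * c ^ 2 * x ^ 2)) n"
    unfolding X(2) using assms by (rule fps_nth_eq_of_mult_one_plus)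
  also have "(u * dl) ^ 2 * (1 + 2 * c * x + 3 * c ^ 2 * x ^ 2) =
    eps ^ 2 + fps_const (2 * v) * (x * eps ^ 2) + fps_const (3 * v ^ 2) * (x ^ 2 * eps ^ 2)"
    unfolding u_dl c_def by (simp add: algebra_simps numeral_fps_const fps_const_power)
  finally show ?thesis
    by (simp only: X fps_add_nth fps_mult_left_const_nth) (simp only: x_def fps_X_power_mult_nth, auto)
qed

lemma dl3_expand:
  assumes "n < 3 * (p - 1)"
  shows "fps_nth (dl ^ 3) n = fps_nth (eps ^ 3) n + (if n < p - 1 then 0 else 3 * v * fps_nth (eps ^ 3) (n - (p - 1)))
    + (if n < 2 * (p - 1) then 0 else 6 * v ^ 2 * fps_nth (eps ^ 3) (n - 2 * (p - 1)))"
proof -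
  define c x where "c = fps_const v" and "x = (fps_X ^ (p - 1) :: rat fps)"
  have X: "x ^ 2 = fps_X ^ (2 * (p - 1))" "x ^ 3 = fps_X ^ (3 * (p - 1))"
    unfolding x_def by (simp_all add: power_mult[symmetric] mult.commute)
  have u: "u = 1 - c * x" by (simp add: u_def c_def x_def)
  have "(1 - c * x) ^ 3 * (1 + 3 * c * x + 6 * c ^ 2 * x ^ 2) =
      1 + x ^ 3 * (15 * c ^ 4 * x - 10 * c ^ 3 - 6 * c ^ 5 * x ^ 2)"
    by (simp add: algebra_simps eval_nat_numeral)
  then have "dl ^ 3 * (1 + x ^ 3 * (15 * c ^ 4 * x - 10 * c ^ 3 - 6 * c ^ 5 * x ^ 2)) =
      (u * dl) ^ 3 * (1 + 3 * c * x + 6 * c ^ 2 * x ^ 2)"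
    unfolding u by (simp add: power_mult_distrib mult_ac)
  then have "fps_nth (dl ^ 3) n = fps_nth ((u * dl) ^ 3 * (1 + 3 * c * x + 6 * c ^ 2 * x ^ 2)) n"
    unfolding X(2) using assms by (rule fps_nth_eq_of_mult_one_plus)
  also have "(u * dl) ^ 3 * (1 + 3 * c * x + 6 * c ^ 2 * x ^ 2) =
    eps ^ 3 + fps_const (3 * v) * (x * eps ^ 3) + fps_const (6 * v ^ 2) * (x ^ 2 * eps ^ 3)"
    unfolding u_dl c_def by (simp add: algebra_simps numeral_fps_const fps_const_power)
  finally show ?thesis
    by (simp only: X fps_add_nth fps_mult_left_const_nth) (simp only: x_def fps_X_power_mult_nth, auto)
qed

end

subsection \<open>Reduction to Bernoulli numbers\<close>

context prime_padic
begin

lemma fps_ideal_add: "f \<in> fps_ideal k \<Longrightarrow> g \<in> fps_ideal k \<Longrightarrow> f + g \<in> fps_ideal k"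
  by (auto simp: fps_ideal_def intro: I_add)

lemma fps_ideal_const_mult: "c \<in> I k \<Longrightarrow> f \<in> fps_ideal l \<Longrightarrow> fps_const c * f \<in> fps_ideal (k + l)"
  by (auto simp: fps_ideal_def intro: I_mult)

lemma fps_ideal_power_cong:
  assumes "f \<in> fps_ideal 1" "g \<in> fps_ideal 1" "f - g \<in> fps_ideal 2"
  shows "f ^ 2 - g ^ 2 \<in> fps_ideal 3" "f ^ 3 - g ^ 3 \<in> fps_ideal 4"
proof -
  have "f ^ 2 - g ^ 2 = (f - g) * (f + g)"
    by (simp add: power2_eq_square algebra_simps)
  then show "f ^ 2 - g ^ 2 \<in> fps_ideal 3"
    using fps_ideal_mult[OF assms(3) fps_ideal_add[OF assms(1,2)]] by simp
  have "f ^ 3 - g ^ 3 = (f - g) * (f ^ 2 + f * g + g ^ 2)"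
    by (simp add: power2_eq_square power3_eq_cube algebra_simps)
  moreover have "f ^ 2 + f * g + g ^ 2 \<in> fps_ideal 2"
    using fps_ideal_power[OF assms(1), of 2] fps_ideal_power[OF assms(2), of 2]
      fps_ideal_mult[OF assms(1,2)] by (auto intro: fps_ideal_add simp: numeral_2_eq_2)
  ultimately show "f ^ 3 - g ^ 3 \<in> fps_ideal 4"
    using fps_ideal_mult[OF assms(3), of "f ^ 2 + f * g + g ^ 2" 2] by simp
qed

text \<open>The linear coefficient e_1 = p (p - 1) / 2 is split off: it is divisible by p only once,
  unlike the other coefficients of odd index.\<close>

definition eta :: "rat fps" where
  "eta = Abs_fps (\<lambda>n. if 2 \<le> n \<and> n \<le> p - 2 then e n else 0)"

text \<open>Powers of this polynomial have the convolutions of divided Bernoulli numbers as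
  coefficients; p - 3 is the last even index before p - 1.\<close>

definition G :: "rat fps" where
  "G = Abs_fps (\<lambda>n. if 2 \<le> n \<and> n \<le> p - 3 then \<B> n else 0)"

end

context large_prime
begin

lemma odd_p: "odd p"
  using prime_odd_nat[OF prime_p] p_ge by simp

lemma power_sum_small_even:
  assumes "even n" "n \<ge> 4" "n + 2 \<le> p"
  shows "S n / of_nat n - P * \<B> n \<in> I 3"
proof -
  have "of_nat (n choose k) * (P ^ k / of_nat (Suc k)) * (P * bernoulli (n - k)) \<in> I 3"
    if k: "k \<in> {1..n}" for k
  proof (cases "k = 1")
    case True
    then show ?thesis using assms by (simp add: bernoulli_odd_eq_0)
  next
    case False
    have "P ^ k / of_nat (Suc k) \<in> I k"
      using k assms by (intro I_div_unit) (auto dest: dvd_imp_le)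
    moreover have "P * bernoulli (n - k) \<in> I 1"
      using k assms by (intro I_mult_right bernoulli_I) auto
    ultimately have "(P ^ k / of_nat (Suc k)) * (P * bernoulli (n - k)) \<in> I 3"
      by (rule I_mult_ge) (use k False in auto)
    then show ?thesis unfolding mult.assoc by (rule I_mult_left[OF of_nat_I])
  qed
  then have "(\<Sum>k=1..n. of_nat (n choose k) * (P ^ k / of_nat (Suc k)) * (P * bernoulli (n - k))) \<in> I 3"
    by (rule I_sum)
  moreover have "n > 0" using assms by simp
  ultimately have "S n - P * bernoulli n \<in> I 3"
    by (simp only: S_bernoulli' add_diff_cancel_left')
  moreover have "\<not> p dvd n" using assms by (auto dest: dvd_imp_le)
  ultimately have "(S n - P * bernoulli n) / of_nat n \<in> I 3" by (rule I_div_unit)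
  then show ?thesis by (simp add: diff_divide_distrib divided_bernoulli_def)
qed

lemma not_dvd_small: "0 < n \<Longrightarrow> n + 2 \<le> p \<Longrightarrow> \<not> p - 1 dvd n"
  by (auto dest: dvd_imp_le)

lemma e_eq_dl: "1 \<le> n \<Longrightarrow> n + 2 \<le> p \<Longrightarrow> fps_nth dl n = e n"
  using dl_nth[of n 0] by (simp add: eps_def)

text \<open>The logarithm to first order: its quadratic term is already divisible by p^2, and -S_n /
  n is -p B_n / n at this precision.\<close>

lemma e_cong_2:
  assumes "even n" "n \<ge> 2" "n + 2 \<le> p"
  shows "e n + P * \<B> n \<in> I 2"
proof -
  have "\<not> p dvd n" using assms by (auto dest: dvd_imp_le)
  then have "(S n - P * bernoulli n) / of_nat n \<in> I 2"
    using power_sum_small[of n] assms by (intro I_div_unit) auto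
  then have 1: "S n / of_nat n - P * \<B> n \<in> I 2"
    by (simp add: diff_divide_distrib divided_bernoulli_def)
  have 2: "- (S n / of_nat n) - (e n - fps_nth (dl ^ 2) n / 2) \<in> I 2"
    using I_antimono[OF log_even_3[of n], of 2] assms not_dvd_small[of n] e_eq_dl[of n] by simp
  have "e n + P * \<B> n = - (S n / of_nat n - P * \<B> n) - (- (S n / of_nat n) - (e n - fps_nth (dl ^ 2) n / 2))
      + fps_nth (dl ^ 2) n / 2"
    by simp
  then show ?thesis using 1 2 half_I[OF dl2_I[of n]] by (simp only: I_add I_diff I_minus)
qed

lemma eta_I1: "eta \<in> fps_ideal 1"
  by (auto simp: fps_ideal_def eta_def intro!: e_I1[unfolded One_nat_def])

lemma G_nth_I: "fps_nth G n \<in> I 0"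
  by (auto simp: G_def intro!: divided_bernoulli_I)

lemma G_I: "G \<in> fps_ideal 0"
  by (simp add: fps_ideal_def G_nth_I)

lemma G_odd: "odd n \<Longrightarrow> fps_nth G n = 0"
  by (cases "n = 1") (auto simp: G_def intro!: divided_bernoulli_odd_eq_0 elim!: oddE)

lemma eta_odd_I2: "odd n \<Longrightarrow> fps_nth eta n \<in> I 2"
  by (cases "n = 1") (auto simp: eta_def intro!: e_odd_I2 elim!: oddE)

text \<open>The two supports differ only at p - 2, an odd index, where \<open>eta\<close> is
  divisible by p^2.\<close>

lemma eta_cong: "fps_nth eta n + P * fps_nth G n \<in> I 2"
proof (cases "odd n")
  case True
  then show ?thesis using eta_odd_I2[of n] G_odd[of n] by simp
next
  case False
  then have "n \<noteq> p - 2" using odd_p p_ge by auto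
  then show ?thesis using False e_cong_2[of n] by (auto simp: eta_def G_def)
qed

lemma eta_power_cong:
  shows eta_square_cong: "fps_nth (eta ^ 2) n - P ^ 2 * fps_nth (G ^ 2) n \<in> I 3"
    and eta_cube_cong: "fps_nth (eta ^ 3) n + P ^ 3 * fps_nth (G ^ 3) n \<in> I 4"
proof -
  have 1: "fps_const (- P) * G \<in> fps_ideal 1"
    using fps_ideal_const_mult[of "- P" 1 G 0] G_I by simp
  have 2: "eta - fps_const (- P) * G \<in> fps_ideal 2"
    using eta_cong by (simp add: fps_ideal_def)
  note c = fps_ideal_power_cong[OF eta_I1 1 2]
  have "(fps_const (- P) * G) ^ 2 = fps_const (P ^ 2) * G ^ 2"
    "(fps_const (- P) * G) ^ 3 = fps_const (- (P ^ 3)) * G ^ 3"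
    by (simp_all only: power_mult_distrib fps_const_power) simp_all
  then show "fps_nth (eta ^ 2) n - P ^ 2 * fps_nth (G ^ 2) n \<in> I 3"
    "fps_nth (eta ^ 3) n + P ^ 3 * fps_nth (G ^ 3) n \<in> I 4"
    using fps_ideal_nth[OF c(1), of n] fps_ideal_nth[OF c(2), of n] by simp_all
qed

lemma fps_square_nth_odd:
  fixes f :: "rat fps"
  assumes "\<And>n. odd n \<Longrightarrow> fps_nth f n = 0" "odd n"
  shows "fps_nth (f ^ 2) n = 0"
proof -
  have "fps_nth f i * fps_nth f (n - i) = 0" if "i \<in> {0..n}" for i
  proof -
    have "odd i \<or> odd (n - i)" using that assms(2) by auto
    then show ?thesis using assms(1)[of i] assms(1)[of "n - i"] by (metis mult_eq_0_iff)
  qed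
  then show ?thesis unfolding power2_eq_square fps_mult_nth by (intro sum.neutral ballI)
qed

lemma eta_square_odd: "odd n \<Longrightarrow> fps_nth (eta ^ 2) n \<in> I 3"
  using eta_square_cong[of n] fps_square_nth_odd[of G n] G_odd by simp

lemma eps_eta: "eps = fps_X * fps_const (e 1) + eta"
  using p_ge by (intro fps_ext) (auto simp: eps_def eta_def fps_X_def Suc_le_eq numeral_2_eq_2)

lemma e_1_I1: "e 1 \<in> I 1"
  using e_I1[of 1] p_ge by simp

lemma eps_square: "eps ^ 2 = fps_X ^ 2 * fps_const ((e 1) ^ 2) + fps_X * (fps_const (2 * e 1) * eta) + eta ^ 2"
proof -
  have "eps ^ 2 = fps_X ^ 2 * fps_const (e 1) ^ 2 + fps_X * ((2 * fps_const (e 1)) * eta) + eta ^ 2"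
    unfolding eps_eta by (simp add: power2_eq_square algebra_simps)
  also have "2 * fps_const (e 1) = fps_const (2 * e 1)" by (simp add: numeral_fps_const)
  finally show ?thesis by (simp only: fps_const_power)
qed

lemma eps_cube: "eps ^ 3 = fps_X ^ 3 * fps_const ((e 1) ^ 3) + fps_X ^ 2 * (fps_const (3 * (e 1) ^ 2) * eta)
  + fps_X * (fps_const (3 * e 1) * eta ^ 2) + eta ^ 3"
proof -
  have "eps ^ 3 = fps_X ^ 3 * fps_const (e 1) ^ 3 + fps_X ^ 2 * ((3 * fps_const (e 1) ^ 2) * eta)
    + fps_X * ((3 * fps_const (e 1)) * eta ^ 2) + eta ^ 3"
    unfolding eps_eta by (simp add: power2_eq_square power3_eq_cube algebra_simps)
  also have "3 * fps_const (e 1) = fps_const (3 * e 1)" by (simp add: numeral_fps_const)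
  also have "3 * fps_const (e 1) ^ 2 = fps_const (3 * (e 1) ^ 2)" by (simp add: numeral_fps_const fps_const_power)
  finally show ?thesis by (simp only: fps_const_power)
qed

lemma eps_square_nth: "n \<ge> 3 \<Longrightarrow> fps_nth (eps ^ 2) n = 2 * e 1 * fps_nth eta (n - 1) + fps_nth (eta ^ 2) n"
  unfolding eps_square by (simp add: fps_X_power_mult_nth)

lemma eps_cube_nth: "n \<ge> 4 \<Longrightarrow> fps_nth (eps ^ 3) n =
    3 * (e 1) ^ 2 * fps_nth eta (n - 2) + 3 * e 1 * fps_nth (eta ^ 2) (n - 1) + fps_nth (eta ^ 3) n"
  unfolding eps_cube by (simp add: fps_X_power_mult_nth)

lemma fps_square_nth_low:
  fixes f :: "rat fps"
  assumes "\<And>n. n < k \<Longrightarrow> fps_nth f n = 0" "n < 2 * k"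
  shows "fps_nth (f ^ 2) n = 0"
proof -
  have "fps_nth f i * fps_nth f (n - i) = 0" if "i \<in> {0..n}" for i
  proof -
    have "i < k \<or> n - i < k" using that assms(2) by auto
    then show ?thesis using assms(1) by auto
  qed
  then show ?thesis unfolding power2_eq_square fps_mult_nth by (intro sum.neutral ballI)
qed

lemma fps_square_nth_high:
  fixes f :: "rat fps"
  assumes "\<And>n. n > k \<Longrightarrow> fps_nth f n = 0" "n > 2 * k"
  shows "fps_nth (f ^ 2) n = 0"
proof -
  have "fps_nth f i * fps_nth f (n - i) = 0" if "i \<in> {0..n}" for i
  proof -
    have "i > k \<or> n - i > k" using that assms(2) by auto
    then show ?thesis using assms(1) by auto
  qed
  then show ?thesis unfolding power2_eq_square fps_mult_nth by (intro sum.neutral ballI)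
qed

lemma eps_square_2: "fps_nth (eps ^ 2) 2 = (e 1) ^ 2"
  using fps_square_nth_low[of 2 eta 2] unfolding eps_square
  by (simp add: fps_X_power_mult_nth eta_def)

lemma eps_square_even_cong:
  assumes "even n" "n \<ge> 4"
  shows "fps_nth (eps ^ 2) n - P ^ 2 * fps_nth (G ^ 2) n \<in> I 3"
proof -
  have *: "e 1 * fps_nth eta (n - 1) \<in> I 3"
    by (rule I_mult_ge[OF e_1_I1 eta_odd_I2]) (use assms in auto)
  have "2 * (e 1 * fps_nth eta (n - 1)) + (fps_nth (eta ^ 2) n - P ^ 2 * fps_nth (G ^ 2) n) \<in> I 3"
    by (rule I_add[OF I_mult_left[OF numeral_I *] eta_square_cong])
  moreover have "fps_nth (eps ^ 2) n - P ^ 2 * fps_nth (G ^ 2) n =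
      2 * (e 1 * fps_nth eta (n - 1)) + (fps_nth (eta ^ 2) n - P ^ 2 * fps_nth (G ^ 2) n)"
    using eps_square_nth[of n] assms by simp
  ultimately show ?thesis by (simp only:)
qed

text \<open>Keeping the quadratic term of the logarithm refines the previous congruence by half a
  convolution.\<close>

lemma e_cong_3:
  assumes "even n" "n \<ge> 4" "n + 2 \<le> p"
  shows "e n - (P ^ 2 * fps_nth (G ^ 2) n / 2 - P * \<B> n) \<in> I 3"
proof -
  have "fps_nth (dl ^ 2) n = fps_nth (eps ^ 2) n"
    using dl2_expand[of n] assms by simp
  then have 1: "- (S n / of_nat n) - (e n - fps_nth (eps ^ 2) n / 2) \<in> I 3"
    using log_even_3[of n] assms not_dvd_small[of n] e_eq_dl[of n] by simp
  have "e n - (P ^ 2 * fps_nth (G ^ 2) n / 2 - P * \<B> n) =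
    - (S n / of_nat n - P * \<B> n) - (- (S n / of_nat n) - (e n - fps_nth (eps ^ 2) n / 2))
    + (fps_nth (eps ^ 2) n - P ^ 2 * fps_nth (G ^ 2) n) / 2"
    by (simp add: field_simps)
  then show ?thesis
    using 1 power_sum_small_even[OF assms] half_I[OF eps_square_even_cong[OF assms(1,2)]]
    by (simp only: I_add I_diff I_minus)
qed

text \<open>Of the cross terms with e_1, one contains the vanishing coefficient of
  \<open>eta\<close>, and the other an odd-index coefficient of its square, divisible by
  p^3.\<close>

lemma eps_cube_even_cong:
  assumes "even n" "n \<ge> 4" "fps_nth eta (n - 2) = 0"
  shows "fps_nth (eps ^ 3) n - fps_nth (eta ^ 3) n \<in> I 4"
proof -
  have "e 1 * fps_nth (eta ^ 2) (n - 1) \<in> I 4"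
    by (rule I_mult_ge[OF e_1_I1 eta_square_odd]) (use assms in auto)
  then have "3 * (e 1 * fps_nth (eta ^ 2) (n - 1)) \<in> I 4" by (rule I_mult_left[OF numeral_I])
  moreover have "fps_nth (eps ^ 3) n - fps_nth (eta ^ 3) n = 3 * (e 1 * fps_nth (eta ^ 2) (n - 1))"
    using eps_cube_nth[of n] assms by simp
  ultimately show ?thesis by (simp only:)
qed

section \<open>Convolutions at p + 1\<close>

definition G' :: "rat fps" where "G' = G - fps_X ^ 2 * fps_const (\<B> 2)"

lemma G'_nth: "fps_nth G' n = (if 3 \<le> n \<and> n \<le> p - 3 then \<B> n else 0)"
  using p_ge by (auto simp: G'_def G_def fps_X_power_mult_nth)

text \<open>At p + 1 the index 2 is paired with p - 1, outside the support of \<open>eta\<close>. So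
  the factor e_2 never occurs, and the cubic correction carries \<open>G'\<close>, where index 2 is
  removed, in place of one \<open>G\<close>.\<close>

lemma eta_square_p_plus_1:
  "fps_nth (eta ^ 2) (p + 1) - (P ^ 2 * fps_nth (G ^ 2) (p + 1) - P ^ 3 * fps_nth (G' * G ^ 2) (p + 1)) \<in> I 4"
proof -
  \<comment> \<open>The correction is split symmetrically in i and p + 1 - i because either factor
    of e_i e_j may contribute its quadratic part; both halves have the same sum.\<close>
  define t where "t i = fps_nth eta i * fps_nth eta (p + 1 - i) - (P ^ 2 * (fps_nth G i * fps_nth G (p + 1 - i))
    - P ^ 3 / 2 * (fps_nth G' i * fps_nth (G ^ 2) (p + 1 - i) + fps_nth (G ^ 2) i * fps_nth G' (p + 1 - i)))" for i
  have "t i \<in> I 4" if i: "i \<in> {0..p + 1}" for i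
  proof -
    define j where "j = p + 1 - i"
    have "even i \<longleftrightarrow> even j" using i odd_p unfolding j_def by auto
    then have "i \<le> 2 \<or> j \<le> 2 \<or> 3 \<le> i \<and> 3 \<le> j \<and> odd i \<or> 4 \<le> i \<and> 4 \<le> j \<and> even i"
      by presburger
    then consider "i \<le> 2" | "j \<le> 2" | "3 \<le> i" "3 \<le> j" "odd i" | "4 \<le> i" "4 \<le> j" "even i"
      by blast
    then show ?thesis
    proof cases
      case 1
      then have "i \<le> 1 \<or> i = 2" by auto
      then show ?thesis using p_ge unfolding t_def by (auto simp: eta_def G_def G'_nth)
    next
      case 2
      then have "i \<ge> p - 1" using i unfolding j_def by auto
      then have "j \<le> 1 \<or> j = 2" using 2 by auto
      then show ?thesis using p_ge \<open>i \<ge> p - 1\<close> unfolding t_def j_def[symmetric] by (auto simp: eta_def G_def G'_nth)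
    next
      case 3
      then have "odd j" using odd_p i unfolding j_def by auto
      then have "fps_nth G' i = 0" "fps_nth G' j = 0" "fps_nth G i = 0" "fps_nth G j = 0"
        using 3 by (auto simp: G'_nth G_odd intro!: divided_bernoulli_odd_eq_0)
      then have "t i = fps_nth eta i * fps_nth eta j" unfolding t_def j_def[symmetric] by simp
      also have "\<dots> \<in> I 4"
        by (rule I_mult_ge[OF eta_odd_I2 eta_odd_I2]) (use 3 \<open>odd j\<close> in auto)
      finally show ?thesis .
    next
      case 4
      have ij: "i \<le> p - 3" "j \<le> p - 3" "i \<le> p - 2" "j \<le> p - 2" "even j" using 4 i odd_p unfolding j_def by auto
      define x y where "x = P * \<B> i" and "y = P * \<B> j"
      define x' y' where "x' = P ^ 2 * fps_nth (G ^ 2) i / 2" and "y' = P ^ 2 * fps_nth (G ^ 2) j / 2"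
      have c: "fps_nth (G ^ 2) n \<in> I 0" for n
        using fps_ideal_nth[OF fps_ideal_mult[OF G_I G_I]] by (simp add: power2_eq_square)
      have xI: "x \<in> I 1" "y \<in> I 1" unfolding x_def y_def
        using ij p_ge by (auto intro!: I_mult_right divided_bernoulli_I)
      have x'I: "x' \<in> I 2" "y' \<in> I 2" unfolding x'_def y'_def
        using half_I I_mult_right[OF P_power_I c] by blast+
      have ei: "e i - (x' - x) \<in> I 3" and ej: "e j - (y' - y) \<in> I 3"
        using e_cong_3[of i] e_cong_3[of j] 4 ij p_ge unfolding x_def y_def x'_def y'_def by auto
      have "e i * e j - (x' - x) * (y' - y) \<in> I 4"
      proof (rule cong_mult[OF ei ej])
        show "e i \<in> I 1" using 4 ij p_ge by (intro e_I1) auto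
        show "y' - y \<in> I 1" by (rule I_diff[OF I_antimono[OF x'I(2)] xI(2)]) simp
      qed auto
      moreover have "x' * y' \<in> I 4" using I_mult[OF x'I] by simp
      ultimately have "(e i * e j - (x' - x) * (y' - y)) + x' * y' \<in> I 4" by (rule I_add)
      also have "(e i * e j - (x' - x) * (y' - y)) + x' * y' = t i"
        using 4 ij p_ge unfolding t_def j_def[symmetric] x_def y_def x'_def y'_def
        by (simp add: eta_def G_def G'_nth field_simps power2_eq_square power3_eq_cube)
      finally show ?thesis .
    qed
  qed
  then have "(\<Sum>i=0..p + 1. t i) \<in> I 4" by (rule I_sum)
  also have "(\<Sum>i=0..p + 1. t i) = fps_nth (eta * eta) (p + 1) - (P ^ 2 * fps_nth (G * G) (p + 1)
     - P ^ 3 / 2 * (fps_nth (G' * G ^ 2) (p + 1) + fps_nth (G ^ 2 * G') (p + 1)))"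
    unfolding t_def fps_mult_nth[of _ _ "p + 1"]
    by (simp only: sum_subtractf sum.distrib sum_distrib_left distrib_left)
  also have "\<dots> = fps_nth (eta ^ 2) (p + 1) - (P ^ 2 * fps_nth (G ^ 2) (p + 1) - P ^ 3 * fps_nth (G' * G ^ 2) (p + 1))"
    by (simp add: power2_eq_square mult.commute mult.left_commute)
  finally show ?thesis .
qed

lemma G_square_nth: "fps_nth (G ^ 2) m = (\<Sum>i | 2 \<le> i \<and> i \<le> p - 3 \<and> i + 2 \<le> m \<and> m \<le> i + (p - 3). \<B> i * \<B> (m - i))"
proof -
  have "fps_nth (G ^ 2) m = (\<Sum>i\<in>{0..m}. fps_nth G i * fps_nth G (m - i))"
    by (simp add: power2_eq_square fps_mult_nth)
  also have "\<dots> = (\<Sum>i | 2 \<le> i \<and> i \<le> p - 3 \<and> i + 2 \<le> m \<and> m \<le> i + (p - 3). \<B> i * \<B> (m - i))"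
    by (rule sum.mono_neutral_cong_right) (auto simp: G_def)
  finally show ?thesis .
qed

lemma bernoulli_conv_G: "m \<le> p - 1 \<Longrightarrow> \<C> m = fps_nth (G ^ 2) m"
  unfolding G_square_nth bernoulli_conv_def using p_ge by (intro sum.cong) auto

text \<open>Truncating \<open>G\<close> at p - 3 forces p + 1 - i <= p - 3, which is the lower limit
  i >= 4.\<close>

lemma truncated_conv4_G: "truncated_conv4 p = fps_nth (G ^ 2) (p + 1)"
  unfolding G_square_nth truncated_conv4_def using p_ge by (intro sum.cong) auto

lemma bernoulli_triple_conv_G: "\<T> (p + 1) = fps_nth (G ^ 3) (p + 1)"
proof -
  have "fps_nth (G ^ 3) (p + 1) = (\<Sum>i\<in>{0..p + 1}. fps_nth G i * fps_nth (G ^ 2) (p + 1 - i))"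
    by (simp add: power3_eq_cube power2_eq_square mult.assoc fps_mult_nth[of G])
  also have "\<dots> = (\<Sum>i=2..p - 3. \<B> i * fps_nth (G ^ 2) (p + 1 - i))"
    by (rule sum.mono_neutral_cong_right) (auto simp: G_def)
  also have "\<dots> = (\<Sum>i=2..p - 3. \<B> i * \<C> (p + 1 - i))"
    by (intro sum.cong refl) (auto simp: bernoulli_conv_G)
  finally show ?thesis using p_ge by (simp add: bernoulli_triple_conv_def)
qed

lemma G'_G_square:
  assumes "n \<ge> 2"
  shows "fps_nth (G' * G ^ 2) n = fps_nth (G ^ 3) n - \<B> 2 * fps_nth (G ^ 2) (n - 2)"
proof -
  have "G' * G ^ 2 = G ^ 3 - fps_X ^ 2 * (fps_const (\<B> 2) * G ^ 2)"
    unfolding G'_def by (simp add: algebra_simps power3_eq_cube power2_eq_square)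
  then show ?thesis using assms by (simp add: fps_X_power_mult_nth)
qed

section \<open>The Wilson quotient and e_2 / v modulo p^4\<close>

abbreviation w :: rat where "w \<equiv> wilson_quotient p"

lemma v_wilson: "v = 1 - P * w"
  by (simp add: v_def wilson_quotient_def)

lemma wilson_I: "w \<in> I 0"
proof -
  have "[fact (p - 1) = - 1] (mod int p)" by (rule wilson_theorem[OF prime_p])
  then have "int p dvd fact (p - 1) + 1"
    by (simp add: cong_iff_dvd_diff)
  then obtain k where "fact (p - 1) + 1 = int p * k" by (elim dvdE)
  then have "(of_int (fact (p - 1) + 1) :: rat) = of_int (int p * k)" by simp
  then have "w = of_int k" by (simp add: wilson_quotient_def)
  then show ?thesis using of_int_I by simp
qed

lemma v_cong_1: "v ^ k - 1 \<in> I 1"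
proof (induction k)
  case (Suc k)
  have "v - 1 = - (P * w)" by (simp add: v_wilson)
  also have "\<dots> \<in> I 1" using I_mult_right[OF P_I wilson_I] by simp
  finally have "v * v ^ k - 1 * 1 \<in> I 1"
    using Suc by (intro cong_mult[of v 1 1 "v ^ k" 1 1 0 0]) (auto intro: v_I)
  then show ?case by simp
qed simp

lemma inverse_v_I: "1 / v \<in> I 0"
proof -
  have "\<not> p dvd fact (p - 1)" using prime_dvd_fact_iff[OF prime_p, of "p - 1"] p_pos by simp
  then show ?thesis using inverse_unit_I[of "fact (p - 1)"] by (simp add: v_def)
qed

lemma eps_cube_2: "fps_nth (eps ^ 3) 2 = 0"
proof -
  have "eps = fps_X * fps_shift 1 eps" by (intro fps_ext) (simp add: eps_def)
  then have "eps ^ 3 = fps_X ^ 3 * fps_shift 1 eps ^ 3" by (metis power_mult_distrib)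
  then show ?thesis by (simp add: fps_X_power_mult_nth)
qed

lemma eps_square_high: "n > 2 * (p - 2) \<Longrightarrow> fps_nth (eps ^ 2) n = 0"
  by (rule fps_square_nth_high[of "p - 2"]) (auto simp: eps_def)

lemma G_square_high: "n > 2 * (p - 3) \<Longrightarrow> fps_nth (G ^ 2) n = 0"
  by (rule fps_square_nth_high[of "p - 3"]) (auto simp: G_def)

lemma not_dvd_add: "0 < m \<Longrightarrow> m < p - 1 \<Longrightarrow> \<not> p - 1 dvd m + k * (p - 1)"
  by (auto simp: dvd_add_times_triv_right_iff dest: dvd_imp_le)

lemma dl2_lift:
  assumes "m < p - 1"
  shows "fps_nth (dl ^ 2) m = fps_nth (eps ^ 2) m"
    "fps_nth (dl ^ 2) (m + (p - 1)) = fps_nth (eps ^ 2) (m + (p - 1)) + 2 * v * fps_nth (eps ^ 2) m"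
    "fps_nth (dl ^ 2) (m + 2 * (p - 1)) = 2 * v * fps_nth (eps ^ 2) (m + (p - 1)) + 3 * v ^ 2 * fps_nth (eps ^ 2) m"
proof -
  define q where "q = p - 1"
  \<comment> \<open>The square of \<open>eps\<close> has degree at most 2 (p - 2), so its own
    coefficient disappears from the third line.\<close>
  have "fps_nth (eps ^ 2) (m + 2 * q) = 0" using p_ge unfolding q_def by (intro eps_square_high) auto
  moreover have "m < q" "m + 2 * q - q = m + q" using assms unfolding q_def by auto
  ultimately show "fps_nth (dl ^ 2) m = fps_nth (eps ^ 2) m"
    "fps_nth (dl ^ 2) (m + (p - 1)) = fps_nth (eps ^ 2) (m + (p - 1)) + 2 * v * fps_nth (eps ^ 2) m"
    "fps_nth (dl ^ 2) (m + 2 * (p - 1)) = 2 * v * fps_nth (eps ^ 2) (m + (p - 1)) + 3 * v ^ 2 * fps_nth (eps ^ 2) m"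
    using dl2_expand[folded q_def, of m] dl2_expand[folded q_def, of "m + q"]
      dl2_expand[folded q_def, of "m + 2 * q"]
    unfolding q_def[symmetric] by (simp_all add: add.commute[of m q])
qed

lemma dl3_lift:
  assumes "m < p - 1"
  shows "fps_nth (dl ^ 3) (m + (p - 1)) = fps_nth (eps ^ 3) (m + (p - 1)) + 3 * v * fps_nth (eps ^ 3) m"
    "fps_nth (dl ^ 3) (m + 2 * (p - 1)) = fps_nth (eps ^ 3) (m + 2 * (p - 1)) +
       3 * v * fps_nth (eps ^ 3) (m + (p - 1)) + 6 * v ^ 2 * fps_nth (eps ^ 3) m"
proof -
  define q where "q = p - 1"
  have "m < q" "m + 2 * q - q = m + q" using assms unfolding q_def by auto
  then show "fps_nth (dl ^ 3) (m + (p - 1)) = fps_nth (eps ^ 3) (m + (p - 1)) + 3 * v * fps_nth (eps ^ 3) m"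
    "fps_nth (dl ^ 3) (m + 2 * (p - 1)) = fps_nth (eps ^ 3) (m + 2 * (p - 1)) +
       3 * v * fps_nth (eps ^ 3) (m + (p - 1)) + 6 * v ^ 2 * fps_nth (eps ^ 3) m"
    using dl3_expand[folded q_def, of "m + q"] dl3_expand[folded q_def, of "m + 2 * q"]
    unfolding q_def[symmetric] by (simp_all add: add.commute[of m q])
qed

lemma eta_high: "n > p - 2 \<Longrightarrow> fps_nth eta n = 0"
  by (simp add: eta_def)

text \<open>Since (1 - v)^3 / v = 1 / v - 3 + 3 v - v^2, and both 1 - v and e_2 are divisible by p,
  e_2 / v is 3 e_2 - 3 v e_2 + v^2 e_2 modulo p^4. The three terms are read off from S_2 and from
  the logarithm at p + 1 and 2 p.\<close>

lemma main_identity: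
  "e 2 / v - (3 * (S (p + 1) / of_nat (p + 1)) - S (2 * p) / of_nat (2 * p)) + 3 / 2 * S 2 +
     (3 / 2 - v) * fps_nth (eta ^ 2) (p + 1) + fps_nth (eta ^ 3) (2 * p) / 3 \<in> I 4"
proof -
  define s1 s2 where "s1 = S (p + 1) / of_nat (p + 1)" and "s2 = S (2 * p) / of_nat (2 * p)"
  define H K K1 where "H = fps_nth (eta ^ 2) (p + 1)" and "K = fps_nth (eta ^ 3) (2 * p)"
    and "K1 = fps_nth (eta ^ 3) (p + 1)"
  define E1 E2 where "E1 = fps_nth (eps ^ 3) (p + 1)" and "E2 = fps_nth (eps ^ 3) (2 * p)"
  define a where "a = e 1"
  have eq: "2 + (p - 1) = p + 1" "2 + 1 * (p - 1) = p + 1" "2 + 2 * (p - 1) = 2 * p" using p_ge by auto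
  have q: "2 < p - 1" using p_ge by simp
  have nd: "\<not> p - 1 dvd p + 1" "\<not> p - 1 dvd 2 * p"
    using not_dvd_add[of 2 1] not_dvd_add[of 2 2] q unfolding eq by auto
  have eps2: "fps_nth eps 2 = e 2" using p_ge by (simp add: eps_def)
  have epsH: "fps_nth (eps ^ 2) (p + 1) = H"
    using eps_square_nth[of "p + 1"] p_ge unfolding H_def by (simp add: eta_high)
  have "fps_nth dl (p + 1) = v * e 2" "fps_nth dl (2 * p) = v ^ 2 * e 2"
    using dl_nth[OF q, of 1] dl_nth[OF q, of 2] unfolding eq eps2 by auto
  moreover have "fps_nth (dl ^ 2) (p + 1) = H + 2 * v * a ^ 2"
    "fps_nth (dl ^ 2) (2 * p) = 2 * v * H + 3 * v ^ 2 * a ^ 2"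
    using dl2_lift[OF q] unfolding eq eps_square_2 epsH a_def by auto
  moreover have "fps_nth (dl ^ 3) (p + 1) = E1" "fps_nth (dl ^ 3) (2 * p) = E2 + 3 * v * E1"
    using dl3_lift[OF q] unfolding eq eps_cube_2 E1_def E2_def by auto
  ultimately have r1: "- s1 - (v * e 2 - (H + 2 * v * a ^ 2) / 2 + E1 / 3) \<in> I 4"
    and r2: "- s2 - (v ^ 2 * e 2 - (2 * v * H + 3 * v ^ 2 * a ^ 2) / 2 + (E2 + 3 * v * E1) / 3) \<in> I 4"
    using log_even[of "p + 1"] log_even[of "2 * p"] nd odd_p p_ge unfolding s1_def s2_def by auto
  have c1: "E1 - K1 \<in> I 4" and c2: "E2 - K \<in> I 4"
    unfolding E1_def E2_def K_def K1_def using p_ge odd_p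
    by (auto intro!: eps_cube_even_cong eta_high)
  have v1: "1 - v \<in> I 1" using v_cong_1[of 1] I_diff_commute by simp
  have K1: "K1 \<in> I 3" unfolding K1_def using fps_ideal_nth[OF fps_ideal_power[OF eta_I1]] .
  then have c3: "(1 - v) * K1 \<in> I 4" using I_mult_ge[OF v1 K1, of 4] by simp
  have c4: "(1 - v) * (E1 - K1) \<in> I 4" using I_mult_left[OF I_integral[OF v1] c1] .
  have e2: "e 2 \<in> I 1" using p_ge by (intro e_I1) auto
  have c5: "(1 - v) ^ 3 * e 2 * (1 / v) \<in> I 4"
    using I_mult_right[OF I_mult[OF I_power[OF v1, of 3] e2] inverse_v_I] by simp
  have "a ^ 2 \<in> I 2" unfolding a_def using I_power[OF e_1_I1, of 2] by simp
  then have c6: "3 * ((1 - v) ^ 2 * a ^ 2) / 2 \<in> I 4"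
    using half_I[OF I_mult_left[OF numeral_I I_mult[OF I_power[OF v1, of 2]]], of "a ^ 2" 2] by simp
  have S2: "S 2 = a ^ 2 - 2 * e 2" using e_2 e_1 unfolding a_def by simp
  have v0: "v \<noteq> 0" by (simp add: v_def)
  \<comment> \<open>An exact identity. The cubic coefficient at p + 1 enters with weight 1 - v and
    so drops out modulo p^4, leaving only the one at 2 p.\<close>
  have "e 2 / v - (3 * s1 - s2) + 3 / 2 * S 2 + (3 / 2 - v) * H + K / 3 =
    3 * (- s1 - (v * e 2 - (H + 2 * v * a ^ 2) / 2 + E1 / 3))
    - (- s2 - (v ^ 2 * e 2 - (2 * v * H + 3 * v ^ 2 * a ^ 2) / 2 + (E2 + 3 * v * E1) / 3))
    + (1 - v) ^ 3 * e 2 * (1 / v) + 3 * ((1 - v) ^ 2 * a ^ 2) / 2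
    + (1 - v) * (E1 - K1) + (1 - v) * K1 - (E2 - K) / 3"
    using v0 unfolding S2 by (simp add: field_simps power2_eq_square power3_eq_cube)
  also have "\<dots> \<in> I 4"
    by (intro I_add I_diff I_mult_left[OF numeral_I] r1 r2 c3 c4 c5 c6 third_I[OF c2])
  finally show ?thesis unfolding s1_def s2_def H_def K_def .
qed

section \<open>Refined Kummer congruences and second differences of power sums\<close>

lemma divided_power_sum_lift:
  assumes m: "even m" "4 \<le> m" "m \<le> p - 3" and k: "k \<le> 2"
  shows "S (m + k * (p - 1)) / of_nat (m + k * (p - 1)) -
    (P * (v ^ k * \<B> m) + of_nat k * P ^ 2 * (fps_nth (G ^ 2) m + fps_nth (G ^ 2) (m + (p - 1))) / 2) \<in> I 3"
proof -
  define n where "n = m + k * (p - 1)"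
  define C C' where "C = fps_nth (G ^ 2) m" and "C' = fps_nth (G ^ 2) (m + (p - 1))"
  define A A' where "A = fps_nth (eps ^ 2) m" and "A' = fps_nth (eps ^ 2) (m + (p - 1))"
  have n: "even n" "n > 0" "\<not> p - 1 dvd n"
    using m odd_p p_ge not_dvd_add[of m k] unfolding n_def by auto
  have "fps_nth dl n = v ^ k * e m"
    using dl_nth[of m k] m p_ge unfolding n_def by (simp add: eps_def)
  moreover have "fps_nth (dl ^ 2) n = of_nat (Suc k) * v ^ k * A + of_nat k * v ^ (k - 1) * A'"
  proof -
    have "m < p - 1" using m p_ge by simp
    moreover have "k = 0 \<or> k = 1 \<or> k = 2" using k by linarith
    ultimately show ?thesis
      using dl2_lift[of m] unfolding n_def A_def A'_def by (elim disjE) simp_all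
  qed
  ultimately have r: "- (S n / of_nat n) - (v ^ k * e m - (of_nat (Suc k) * v ^ k * A + of_nat k * v ^ (k - 1) * A') / 2) \<in> I 3"
    using log_even_3[OF n] by simp
  have c1: "e m - (P ^ 2 * C / 2 - P * \<B> m) \<in> I 3"
    unfolding C_def using m p_ge by (intro e_cong_3) auto
  have c2: "A - P ^ 2 * C \<in> I 3" and c3: "A' - P ^ 2 * C' \<in> I 3"
    unfolding C_def C'_def A_def A'_def using m odd_p p_ge by (auto intro!: eps_square_even_cong)
  have C: "fps_nth (G ^ 2) i \<in> I 0" for i
    using fps_ideal_nth[OF fps_ideal_mult[OF G_I G_I]] by (simp add: power2_eq_square)
  have PC: "(v ^ j - 1) * (P ^ 2 * fps_nth (G ^ 2) i) \<in> I 3" for i j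
    using I_mult_ge[OF v_cong_1[of j] I_mult_right[OF P_power_I[of 2] C[of i]], of 3] by simp
  have vI: "v ^ j \<in> I 0" for j using v_I by (rule I_power_0)
  \<comment> \<open>With v^k replaced by 1 in the quadratic terms, the convolution at m has weight
    -(k + 1) / 2 from the square of \<open>dl\<close> and +1 / 2 from e_m, which leaves -k /
    2.\<close>
  have "S n / of_nat n - (P * (v ^ k * \<B> m) + of_nat k * P ^ 2 * (C + C') / 2) =
    - (- (S n / of_nat n) - (v ^ k * e m - (of_nat (Suc k) * v ^ k * A + of_nat k * v ^ (k - 1) * A') / 2))
    - v ^ k * (e m - (P ^ 2 * C / 2 - P * \<B> m))
    + of_nat (Suc k) * (v ^ k * (A - P ^ 2 * C)) / 2 + of_nat k * (v ^ (k - 1) * (A' - P ^ 2 * C')) / 2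
    + of_nat k * ((v ^ k - 1) * (P ^ 2 * C)) / 2 + of_nat k * ((v ^ (k - 1) - 1) * (P ^ 2 * C')) / 2"
    by (simp add: field_simps)
  also have "\<dots> \<in> I 3"
    by (intro I_add I_diff I_minus r half_I I_mult_left[OF vI] I_mult_left[OF of_nat_I] c1 c2 c3 PC[folded C_def]
      PC[of _ m, folded C_def] PC[of _ "m + (p - 1)", folded C'_def])
  finally show ?thesis unfolding n_def C_def C'_def .
qed

lemma bernoulli_even_I:
  assumes "even n" "n \<ge> 4" "\<not> p - 1 dvd n"
  shows "bernoulli n \<in> I 0"
proof -
  have "of_nat n * (S n / of_nat n) \<in> I 1"
    using divided_power_sum_I1[of n] assms by (intro I_mult_left) auto
  then have 1: "S n \<in> I 1" using assms by simp
  have "S n - P * bernoulli n \<in> I 1"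
    by (rule I_antimono[OF power_sum_even[OF assms(1,2)]]) simp
  then have "P * bernoulli n \<in> I 1" using 1 I_diff[of "S n" 1 "S n - P * bernoulli n"] by simp
  then show ?thesis using P_mult_I_iff[of "bernoulli n" 0] by simp
qed

text \<open>A Kummer congruence modulo p^2: the power-sum formula and the logarithm both evaluate
  S_n / n modulo p^3, and a factor p is cancelled. The term with B_(n-2) is a multiple of p^3
  because p - 1 does not divide n - 2.\<close>

lemma divided_bernoulli_lift:
  assumes m: "even m" "4 \<le> m" "m \<le> p - 3"
  shows "\<B> (m + (p - 1)) - (v * \<B> m + P * (fps_nth (G ^ 2) m + fps_nth (G ^ 2) (m + (p - 1))) / 2) \<in> I 2"
proof -
  define n where "n = m + (p - 1)"
  have "n - 2 = m - 2 + 1 * (p - 1)" using m unfolding n_def by simp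
  then have "\<not> p - 1 dvd n - 2" using not_dvd_add[of "m - 2" 1] m p_ge by simp
  then have n: "even n" "n \<ge> 6" "\<not> p - 1 dvd n - 2" "even (n - 2)"
    using m odd_p p_ge unfolding n_def by auto
  have "bernoulli (n - 2) \<in> I 0" using n by (intro bernoulli_even_I) auto
  then have "of_nat (n - 1) * bernoulli (n - 2) \<in> I 0" by (intro I_mult_left) auto
  then have "P ^ 3 * (of_nat (n - 1) * bernoulli (n - 2)) / 2 / 3 \<in> I 3"
    by (intro third_I half_I I_mult_right[OF P_power_I])
  then have 1: "P ^ 3 * of_nat (n - 1) / 6 * bernoulli (n - 2) \<in> I 3" by (simp add: mult.assoc)
  have 2: "S n / of_nat n - (P * \<B> n + P ^ 3 * of_nat (n - 1) / 6 * bernoulli (n - 2)) \<in> I 3"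
    by (rule I_antimono[OF divided_power_sum_even]) (use n in auto)
  have 3: "S n / of_nat n - (P * (v * \<B> m) + P ^ 2 * (fps_nth (G ^ 2) m + fps_nth (G ^ 2) n) / 2) \<in> I 3"
    using divided_power_sum_lift[OF m, of 1] unfolding n_def by simp
  have "P * (\<B> n - (v * \<B> m + P * (fps_nth (G ^ 2) m + fps_nth (G ^ 2) n) / 2)) =
    (S n / of_nat n - (P * (v * \<B> m) + P ^ 2 * (fps_nth (G ^ 2) m + fps_nth (G ^ 2) n) / 2))
    - (S n / of_nat n - (P * \<B> n + P ^ 3 * of_nat (n - 1) / 6 * bernoulli (n - 2)))
    - P ^ 3 * of_nat (n - 1) / 6 * bernoulli (n - 2)"
    by (simp add: algebra_simps power2_eq_square)
  also have "\<dots> \<in> I 3" by (intro I_diff 1 2 3)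
  finally show ?thesis
    unfolding n_def using P_mult_I_iff[of _ 2] by (simp add: numeral_3_eq_3 numeral_2_eq_2)
qed

lemma fermat_quotient_I:
  assumes "a \<in> {1..p - 1}" shows "fermat_quotient p a \<in> I 0"
proof -
  have "\<not> p dvd a" using assms by (auto dest: dvd_imp_le)
  then have "[a ^ (p - 1) = 1] (mod p)" by (rule fermat_theorem[OF prime_p])
  then have "[int (a ^ (p - 1)) = int 1] (mod int p)" by (simp only: cong_int_iff)
  then have "int p dvd int (a ^ (p - 1)) - int 1" by (simp only: cong_iff_dvd_diff)
  then obtain k where "int (a ^ (p - 1)) - int 1 = int p * k" by (elim dvdE)
  then have "(of_int (int (a ^ (p - 1)) - int 1) :: rat) = of_int (int p * k)" by simp
  then have "fermat_quotient p a = of_int k" by (simp add: fermat_quotient_def)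
  then show ?thesis using of_int_I by simp
qed

text \<open>Since p q_a = a^(p-1) - 1, p^2 times the sum is the second difference S_(m+2(p-1)) - 2
  S_(m+p-1) + S_m. Evaluating it modulo p^3 gives the sum modulo p.\<close>

lemma sum_power_fermat_quotient_square:
  assumes m: "even m" "4 \<le> m" "m \<le> p - 3"
  shows "(\<Sum>a=1..p - 1. of_nat a ^ m * fermat_quotient p a ^ 2) -
    (2 * w * \<B> m - (fps_nth (G ^ 2) m + fps_nth (G ^ 2) (m + (p - 1)))) \<in> I 1"
proof -
  define Q where "Q = (\<Sum>a=1..p - 1. of_nat a ^ m * fermat_quotient p a ^ 2)"
  define D where "D = fps_nth (G ^ 2) m + fps_nth (G ^ 2) (m + (p - 1))"
  define n where "n k = m + k * (p - 1)" for k
  define s where "s k = S (n k) / of_nat (n k)" for k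
  define r where "r k = s k - (P * (v ^ k * \<B> m) + of_nat k * P ^ 2 * D / 2)" for k
  have r: "r k \<in> I 3" if "k \<le> 2" for k
    unfolding r_def s_def n_def D_def using divided_power_sum_lift[OF m that] .
  have Sn: "S (n k) = of_nat (n k) * s k" for k
  proof -
    have "n k \<noteq> 0" using m unfolding n_def by simp
    then show ?thesis unfolding s_def by simp
  qed
  have "P ^ 2 * Q = (\<Sum>a=1..p - 1. of_nat a ^ n 2 - 2 * of_nat a ^ n 1 + of_nat a ^ n 0)"
    unfolding Q_def sum_distrib_left
  proof (rule sum.cong[OF refl])
    fix a
    define y :: rat where "y = of_nat a ^ (p - 1)"
    have "of_nat a ^ n k = of_nat a ^ m * y ^ k" for k
      unfolding n_def power_add y_def by (simp only: power_mult mult.commute[of k])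
    then have "of_nat a ^ n 2 - 2 * of_nat a ^ n 1 + of_nat a ^ n 0 = of_nat a ^ m * (y - 1) ^ 2"
      by (simp add: power2_eq_square algebra_simps)
    also have "\<dots> = P ^ 2 * (of_nat a ^ m * fermat_quotient p a ^ 2)"
      by (simp add: fermat_quotient_def y_def power_divide)
    finally show "P ^ 2 * (of_nat a ^ m * fermat_quotient p a ^ 2) =
       of_nat a ^ n 2 - 2 * of_nat a ^ n 1 + of_nat a ^ n 0" by simp
  qed
  also have "\<dots> = S (n 2) - 2 * S (n 1) + S (n 0)"
    by (simp add: power_sum_def sum.distrib sum_subtractf sum_distrib_left)
  finally have PQ: "P ^ 2 * Q = of_nat (n 2) * s 2 - 2 * (of_nat (n 1) * s 1) + of_nat (n 0) * s 0"
    unfolding Sn .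
  have s: "s k = r k + (P * (v ^ k * \<B> m) + of_nat k * P ^ 2 * D / 2)" for k
    unfolding r_def by simp
  have nk: "of_nat (n k) = of_nat m + of_nat k * (P - 1)" for k
    unfolding n_def using p_pos by (simp add: of_nat_diff)
  have "P ^ 2 * (Q - (2 * w * \<B> m - D)) =
    of_nat (n 2) * r 2 - 2 * (of_nat (n 1) * r 1) + of_nat (n 0) * r 0
    + P ^ 3 * (of_nat m * w ^ 2 * \<B> m + 2 * w ^ 2 * (P - 1) * \<B> m - 2 * w * \<B> m + D)"
    unfolding right_diff_distrib PQ s v_wilson unfolding nk
    by (simp add: field_simps power2_eq_square power3_eq_cube)
  also have "\<dots> \<in> I 3"
  proof -
    have C: "fps_nth (G ^ 2) i \<in> I 0" for i
      using fps_ideal_nth[OF fps_ideal_mult[OF G_I G_I]] by (simp add: power2_eq_square)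
    have bI: "\<B> m \<in> I 0" using m p_ge by (intro divided_bernoulli_I) auto
    have "P \<in> I 0" by simp
    then have "of_nat m * w ^ 2 * \<B> m + 2 * w ^ 2 * (P - 1) * \<B> m - 2 * w * \<B> m + D \<in> I 0"
      unfolding D_def using C bI wilson_I I_power_0[OF wilson_I, of 2]
      by (simp only: I_add I_diff I_mult_right of_nat_I one_I numeral_I)
    then have 1: "P ^ 3 * (of_nat m * w ^ 2 * \<B> m + 2 * w ^ 2 * (P - 1) * \<B> m - 2 * w * \<B> m + D) \<in> I 3"
      by (intro I_mult_right) auto
    show ?thesis
      by (intro I_add I_diff I_mult_left[OF of_nat_I] I_mult_left[OF numeral_I] r 1) auto
  qed
  finally show ?thesis
    unfolding Q_def D_def using P_power_mult_I_iff[of 2 _ 1] by (simp add: numeral_3_eq_3 numeral_2_eq_2)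
qed

end

subsection \<open>Fermat quotients\<close>

context large_prime
begin

lemma G_power_I: "fps_nth (G ^ k) i \<in> I 0"
proof -
  have "G ^ k \<in> fps_ideal 0"
  proof (induction k)
    case 0
    then show ?case by (auto simp: fps_ideal_def)
  next
    case (Suc k)
    then show ?case using fps_ideal_mult[OF G_I Suc] by simp
  qed
  then show ?thesis by (rule fps_ideal_nth)
qed

text \<open>The weight i comes from the operator X d/dX, and G^k times the derivative of G is the
  derivative of G^(k+1) / (k + 1).\<close>

lemma weighted_G_convolution:
  assumes "n > 0"
  shows "(\<Sum>i=0..n. of_nat i * fps_nth G i * fps_nth (G ^ k) (n - i)) =
    of_nat n * fps_nth (G ^ Suc k) n / of_nat (Suc k)"
proof -
  have "(\<Sum>i=0..n. of_nat i * fps_nth G i * fps_nth (G ^ k) (n - i)) = fps_nth ((fps_X * fps_deriv G) * G ^ k) n"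
    unfolding fps_mult_nth[of "fps_X * fps_deriv G"] by (intro sum.cong refl) (auto simp: gr0_conv_Suc)
  also have "\<dots> = fps_nth (fps_X * (G ^ k * fps_deriv G)) n"
    by (simp add: mult_ac)
  also have "\<dots> = fps_nth (G ^ k * fps_deriv G) (n - 1)"
    using assms by simp
  finally show ?thesis using fps_deriv_power_nth[OF assms] by simp
qed

text \<open>As B_i = i (B_i / i), the weight is i - 2, which kills index 2. Relative to the full
  support of \<open>G\<close> the range 6..p-5 omits the even indices 4 and p - 3, with weights 2
  and p - 5.\<close>

lemma shifted_G_convolution:
  assumes "n \<ge> p - 3"
  shows "(\<Sum>i=6..p - 5. (bernoulli i - 2 * \<B> i) * fps_nth (G ^ k) (n - i)) =
    (of_nat n / of_nat (Suc k) - 2) * fps_nth (G ^ Suc k) n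
    - 2 * \<B> 4 * fps_nth (G ^ k) (n - 4) - (P - 5) * \<B> (p - 3) * fps_nth (G ^ k) (n - (p - 3))"
proof -
  define t where "t i = (of_nat i - 2) * fps_nth G i * fps_nth (G ^ k) (n - i)" for i
  have "(\<Sum>i=0..n. t i) = (\<Sum>i=0..n. of_nat i * fps_nth G i * fps_nth (G ^ k) (n - i))
     - 2 * (\<Sum>i=0..n. fps_nth G i * fps_nth (G ^ k) (n - i))"
    by (simp add: t_def algebra_simps sum_subtractf sum_distrib_left)
  also have "\<dots> = (of_nat n / of_nat (Suc k) - 2) * fps_nth (G ^ Suc k) n"
    using weighted_G_convolution[of n k] assms p_ge by (simp add: fps_mult_nth[of G "G ^ k"] algebra_simps)
  also have "(\<Sum>i=0..n. t i) = (\<Sum>i\<in>insert 4 (insert (p - 3) {6..p - 5}). t i)"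
  proof (rule sum.mono_neutral_right)
    show "insert 4 (insert (p - 3) {6..p - 5}) \<subseteq> {0..n}" using assms p_ge by auto
    show "\<forall>i\<in>{0..n} - insert 4 (insert (p - 3) {6..p - 5}). t i = 0"
    proof
      fix i assume "i \<in> {0..n} - insert 4 (insert (p - 3) {6..p - 5})"
      then have "i \<noteq> 4" "i \<noteq> p - 3" "i < 6 \<or> i > p - 5" by auto
      then have "i \<le> 1 \<or> i = 2 \<or> odd i \<or> i > p - 3"
        using odd_p p_ge by presburger
      then show "t i = 0" using p_ge by (auto simp: t_def G_odd) (auto simp: G_def)
    qed
  qed simp
  also have "\<dots> = t 4 + t (p - 3) + (\<Sum>i=6..p - 5. t i)"
    using p_ge by (subst sum.insert, simp, force, subst sum.insert) auto
  also have "t 4 = 2 * \<B> 4 * fps_nth (G ^ k) (n - 4)"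
    using p_ge by (simp add: t_def G_def)
  also have "t (p - 3) = (P - 5) * \<B> (p - 3) * fps_nth (G ^ k) (n - (p - 3))"
    using p_ge by (simp add: t_def G_def of_nat_diff)
  also have "(\<Sum>i=6..p - 5. t i) = (\<Sum>i=6..p - 5. (bernoulli i - 2 * \<B> i) * fps_nth (G ^ k) (n - i))"
    by (intro sum.cong refl) (auto simp: t_def G_def divided_bernoulli_def field_simps)
  finally show ?thesis by (simp add: algebra_simps)
qed

definition fermat_quotient_sum :: rat where
  "fermat_quotient_sum = (\<Sum>a = 1..p - 1. (\<Sum>i = 6..p - 5. (bernoulli i - 2 * \<B> i) / of_nat a ^ i) * (of_nat a * fermat_quotient p a)^2)"

text \<open>After exchanging the sums, Fermat's little theorem turns a^(2-i) into a^(p+1-i) modulo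
  p, so that the second-difference evaluation applies with m = p + 1 - i. Odd i contribute
  nothing.\<close>

lemma fermat_quotient_sum_convolutions:
  "fermat_quotient_sum - (\<Sum>i=6..p - 5. (bernoulli i - 2 * \<B> i) *
     (2 * w * \<B> (p + 1 - i) - (fps_nth (G ^ 2) (p + 1 - i) + fps_nth (G ^ 2) (2 * p - i)))) \<in> I 1"
proof -
  let ?b = "\<lambda>i. bernoulli i - 2 * \<B> i" and ?q = "fermat_quotient p"
  have bI: "?b i \<in> I 0" if "i \<in> {6..p - 5}" for i
    using that by (intro I_diff I_mult_left[OF numeral_I] bernoulli_I divided_bernoulli_I) auto
  have "fermat_quotient_sum = (\<Sum>i=6..p - 5. ?b i * (\<Sum>a=1..p - 1. (of_nat a) ^ 2 * (?q a) ^ 2 / of_nat a ^ i))"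
    unfolding fermat_quotient_sum_def sum_distrib_right sum_distrib_left
    by (subst sum.swap) (simp add: power_mult_distrib mult_ac)
  then have "fermat_quotient_sum - (\<Sum>i=6..p - 5. ?b i *
     (2 * w * \<B> (p + 1 - i) - (fps_nth (G ^ 2) (p + 1 - i) + fps_nth (G ^ 2) (2 * p - i)))) =
    (\<Sum>i=6..p - 5. ?b i * ((\<Sum>a=1..p - 1. (of_nat a) ^ 2 * (?q a) ^ 2 / of_nat a ^ i) -
     (2 * w * \<B> (p + 1 - i) - (fps_nth (G ^ 2) (p + 1 - i) + fps_nth (G ^ 2) (2 * p - i)))))"
    by (simp add: sum_subtractf[symmetric] right_diff_distrib)
  also have "\<dots> \<in> I 1"
  proof (rule I_sum)
    fix i assume i: "i \<in> {6..p - 5}"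
    define m where "m = p + 1 - i"
    define R where "R = 2 * w * \<B> m - (fps_nth (G ^ 2) m + fps_nth (G ^ 2) (2 * p - i))"
    show "?b i * ((\<Sum>a=1..p - 1. (of_nat a) ^ 2 * (?q a) ^ 2 / of_nat a ^ i) -
     (2 * w * \<B> (p + 1 - i) - (fps_nth (G ^ 2) (p + 1 - i) + fps_nth (G ^ 2) (2 * p - i)))) \<in> I 1"
      unfolding m_def[symmetric] R_def[symmetric]
    proof (cases "odd i")
      case True
      then have "?b i = 0" using i by (simp add: bernoulli_odd_eq_0 divided_bernoulli_odd_eq_0)
      then show "?b i * ((\<Sum>a=1..p - 1. (of_nat a) ^ 2 * (?q a) ^ 2 / of_nat a ^ i) - R) \<in> I 1" by simp
    next
      case False
      have m: "even m" "4 \<le> m" "m \<le> p - 3" "m + (p - 1) = 2 * p - i"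
        using i False odd_p p_ge unfolding m_def by auto
      have 1: "(\<Sum>a=1..p - 1. of_nat a ^ m * ?q a ^ 2) - R \<in> I 1"
        using sum_power_fermat_quotient_square[OF m(1-3)] unfolding R_def m(4) .
      have 2: "(\<Sum>a=1..p - 1. of_nat a ^ m * ?q a ^ 2 - (of_nat a) ^ 2 * (?q a) ^ 2 / of_nat a ^ i) \<in> I 1"
      proof (rule I_sum)
        fix a assume a: "a \<in> {1..p - 1}"
        define x :: rat where "x = of_nat a"
        have x0: "x \<noteq> 0" using a unfolding x_def by auto
        have q: "x ^ (p - 1) = 1 + P * ?q a" by (simp add: fermat_quotient_def x_def)
        have "x ^ i * x ^ m = x ^ 2 * x ^ (p - 1)"
          unfolding power_add[symmetric] m_def using i by (intro arg_cong[of _ _ "power x"]) auto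
        then have "x ^ m = x ^ 2 * (1 + P * ?q a) / x ^ i"
          using x0 unfolding q by (simp add: field_simps)
        then have "x ^ m * ?q a ^ 2 - x ^ 2 * ?q a ^ 2 / x ^ i = P * (?q a ^ 3 * x ^ 2 * (1 / x) ^ i)"
          using x0 by (simp add: field_simps power2_eq_square power3_eq_cube)
        also have "\<dots> \<in> I 1"
        proof -
          have "1 / x \<in> I 0" unfolding x_def using a p_ge by (intro inverse_less_I) auto
          then have "?q a ^ 3 * x ^ 2 * (1 / x) ^ i \<in> I 0"
            using fermat_quotient_I[OF a] of_nat_I[of a] unfolding x_def by (intro I_mult_left I_power_0)
          then show ?thesis using I_mult_right[OF P_I] by simp
        qed
        finally show "of_nat a ^ m * ?q a ^ 2 - (of_nat a) ^ 2 * (?q a) ^ 2 / of_nat a ^ i \<in> I 1"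
          unfolding x_def .
      qed
      have "(\<Sum>a=1..p - 1. (of_nat a) ^ 2 * (?q a) ^ 2 / of_nat a ^ i) - R =
        ((\<Sum>a=1..p - 1. of_nat a ^ m * ?q a ^ 2) - R) -
        (\<Sum>a=1..p - 1. of_nat a ^ m * ?q a ^ 2 - (of_nat a) ^ 2 * (?q a) ^ 2 / of_nat a ^ i)"
        by (simp add: sum_subtractf)
      then have "(\<Sum>a=1..p - 1. (of_nat a) ^ 2 * (?q a) ^ 2 / of_nat a ^ i) - R \<in> I 1"
        using I_diff[OF 1 2] by (simp only:)
      then show "?b i * ((\<Sum>a=1..p - 1. (of_nat a) ^ 2 * (?q a) ^ 2 / of_nat a ^ i) - R) \<in> I 1"
        by (rule I_mult_left[OF bI[OF i]])
    qed
  qed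
  finally show ?thesis .
qed

text \<open>The shifted convolution is applied at n = p + 1 with k = 1 and k = 2, and at n = 2 p
  with k = 2. Setting p = 0 in the factors n / (k + 1) - 2 gives -3/2, -5/3 and -2.\<close>

lemma fermat_quotient_sum_cong:
  defines "TC \<equiv> fps_nth (G ^ 2) (p + 1)" and "T \<equiv> fps_nth (G ^ 3) (p + 1)" and "U \<equiv> fps_nth (G ^ 3) (2 * p)"
  shows "fermat_quotient_sum - (- 3 * w * (TC - 2 * \<B> 4 * \<B> (p - 3)) + 5 / 3 * T + 2 * U + 2 * \<B> 4 * fps_nth (G ^ 2) (p - 3)
    - 5 * \<B> (p - 3) * (fps_nth (G ^ 2) 4 + fps_nth (G ^ 2) (p + 3))) \<in> I 1"
proof -
  let ?b = "\<lambda>i. bernoulli i - 2 * \<B> i"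
  define C3 C4 C5 where "C3 = fps_nth (G ^ 2) (p - 3)" and "C4 = fps_nth (G ^ 2) 4" and "C5 = fps_nth (G ^ 2) (p + 3)"
  have n: "p + 1 - 4 = p - 3" "p + 1 - (p - 3) = 4" "2 * p - (p - 3) = p + 3" using p_ge by auto
  have Gn: "fps_nth (G ^ 1) (p - 3) = \<B> (p - 3)" "fps_nth (G ^ 1) 4 = \<B> 4"
    using p_ge by (simp_all add: G_def)
  have G0: "fps_nth (G ^ 2) (2 * p - 4) = 0" using p_ge by (intro G_square_high) auto
  have "(\<Sum>i=6..p - 5. ?b i * \<B> (p + 1 - i)) = (\<Sum>i=6..p - 5. ?b i * fps_nth (G ^ 1) (p + 1 - i))"
    by (intro sum.cong refl) (auto simp: G_def)
  also have "\<dots> = ((P + 1) / 2 - 2) * TC - 2 * \<B> 4 * \<B> (p - 3) - (P - 5) * \<B> (p - 3) * \<B> 4"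
    using shifted_G_convolution[of "p + 1" 1] unfolding n Gn TC_def
    by (simp add: numeral_2_eq_2 add.commute)
  finally have s1: "(\<Sum>i=6..p - 5. ?b i * \<B> (p + 1 - i)) =
    ((P + 1) / 2 - 2) * TC - 2 * \<B> 4 * \<B> (p - 3) - (P - 5) * \<B> (p - 3) * \<B> 4" .
  have s2: "(\<Sum>i=6..p - 5. ?b i * fps_nth (G ^ 2) (p + 1 - i)) =
    ((P + 1) / 3 - 2) * T - 2 * \<B> 4 * C3 - (P - 5) * \<B> (p - 3) * C4"
    using shifted_G_convolution[of "p + 1" 2] unfolding n T_def C3_def C4_def
    by (simp add: numeral_3_eq_3 add.commute)
  have s3: "(\<Sum>i=6..p - 5. ?b i * fps_nth (G ^ 2) (2 * p - i)) =
    (2 * P / 3 - 2) * U - (P - 5) * \<B> (p - 3) * C5"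
    using shifted_G_convolution[of "2 * p" 2] G0 unfolding n U_def C5_def
    by (simp add: numeral_3_eq_3 add.commute)
  have "(\<Sum>i=6..p - 5. ?b i * (2 * w * \<B> (p + 1 - i) - (fps_nth (G ^ 2) (p + 1 - i) + fps_nth (G ^ 2) (2 * p - i)))) =
    2 * w * (\<Sum>i=6..p - 5. ?b i * \<B> (p + 1 - i)) - ((\<Sum>i=6..p - 5. ?b i * fps_nth (G ^ 2) (p + 1 - i)) +
      (\<Sum>i=6..p - 5. ?b i * fps_nth (G ^ 2) (2 * p - i)))"
    by (simp only: sum_subtractf[symmetric] sum.distrib[symmetric] sum_distrib_left right_diff_distrib distrib_left mult_ac)
  then have z: "fermat_quotient_sum - (2 * w * (((P + 1) / 2 - 2) * TC - 2 * \<B> 4 * \<B> (p - 3) - (P - 5) * \<B> (p - 3) * \<B> 4)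
    - ((((P + 1) / 3 - 2) * T - 2 * \<B> 4 * C3 - (P - 5) * \<B> (p - 3) * C4) +
       ((2 * P / 3 - 2) * U - (P - 5) * \<B> (p - 3) * C5))) \<in> I 1" (is "fermat_quotient_sum - ?R \<in> _")
    using fermat_quotient_sum_convolutions unfolding s1 s2 s3 by simp
  have e: "?R - (- 3 * w * (TC - 2 * \<B> 4 * \<B> (p - 3)) + 5 / 3 * T + 2 * U + 2 * \<B> 4 * C3
    - 5 * \<B> (p - 3) * (C4 + C5)) =
    P * (w * TC - 2 * (w * (\<B> (p - 3) * \<B> 4)) - T / 3 + \<B> (p - 3) * C4 - 2 * U / 3 + \<B> (p - 3) * C5)"
    by (simp add: field_simps)
  have "P * (w * TC - 2 * (w * (\<B> (p - 3) * \<B> 4)) - T / 3 + \<B> (p - 3) * C4 - 2 * U / 3 + \<B> (p - 3) * C5) \<in> I 1"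
  proof -
    have "\<B> (p - 3) \<in> I 0" "\<B> 4 \<in> I 0" using p_ge by (auto intro!: divided_bernoulli_I)
    then have "w * TC - 2 * (w * (\<B> (p - 3) * \<B> 4)) - T / 3 + \<B> (p - 3) * C4 - 2 * U / 3 + \<B> (p - 3) * C5 \<in> I 0"
      unfolding TC_def T_def U_def C4_def C5_def
      by (intro I_add I_diff third_I I_mult_left[OF numeral_I] G_power_I
        I_mult_left[OF wilson_I] I_mult_left[of "\<B> (p - 3)"])
    then show ?thesis using I_mult_right[OF P_I] by simp
  qed
  then have "?R - (- 3 * w * (TC - 2 * \<B> 4 * \<B> (p - 3)) + 5 / 3 * T + 2 * U + 2 * \<B> 4 * C3
    - 5 * \<B> (p - 3) * (C4 + C5)) \<in> I 1"
    unfolding e .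
  from I_trans[OF z this] show ?thesis unfolding C3_def C4_def C5_def .
qed

section \<open>From convolutions back to the harmonic sum\<close>

lemma A_star_eq: "A_star p (p - 3) = - (e 2 / v)"
proof -
  let ?A = "{1..p - 1}"
  have nz: "(\<Prod>a\<in>J. of_nat a :: rat) \<noteq> 0" if "J \<subseteq> ?A" for J
    using that finite_subset[OF that] by auto
  have "A_star p (p - 3) = (\<Sum>J | J \<subseteq> ?A \<and> card J = 2. (\<Prod>a\<in>J. of_nat a) / fact (p - 1))"
    unfolding A_star_def
  \<comment> \<open>Complementation: the reciprocal product over p - 3 of the numbers 1, ..., p - 1
    is the product of the other two divided by (p - 1)!.\<close>
  proof (rule sum.reindex_bij_witness[of _ "\<lambda>J. ?A - J" "\<lambda>J. ?A - J"])
    fix J assume J: "J \<in> {I. I \<subseteq> ?A \<and> card I = p - 3}"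
    then have fin: "finite J" using finite_subset by auto
    show "?A - (?A - J) = J" using J by auto
    show "?A - J \<in> {J. J \<subseteq> ?A \<and> card J = 2}"
      using J fin p_ge by (auto simp: card_Diff_subset)
    have "(fact (p - 1) :: rat) = (\<Prod>a\<in>?A. of_nat a)" by (simp add: fact_prod)
    also have "\<dots> = (\<Prod>a\<in>?A - J. of_nat a) * (\<Prod>a\<in>J. of_nat a)"
      using J by (intro prod.subset_diff) auto
    finally show "(\<Prod>a\<in>?A - J. of_nat a) / fact (p - 1) = 1 / (\<Prod>i\<in>J. of_nat i :: rat)"
      using nz[of J] nz[of "?A - J"] J by simp
  next
    fix J assume J: "J \<in> {J. J \<subseteq> ?A \<and> card J = 2}"
    then have fin: "finite J" using finite_subset by auto
    show "?A - (?A - J) = J" using J by auto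
    show "?A - J \<in> {I. I \<subseteq> ?A \<and> card I = p - 3}"
      using J fin by (auto simp: card_Diff_subset)
  qed
  also have "\<dots> = e 2 / fact (p - 1)"
    by (simp add: e_eq sum_divide_distrib)
  finally show ?thesis by (simp add: v_def)
qed

lemma I_mult_0: "x \<in> I 0 \<Longrightarrow> y \<in> I 0 \<Longrightarrow> x * y \<in> I 0"
  by (rule I_mult_left)

text \<open>The quotient S_(2p) / (2 p) is divisible by p, so S_(2p), and with it p B_(2p), is
  divisible by p^2.\<close>

lemma bernoulli_2p_I1: "bernoulli (2 * p) \<in> I 1"
proof -
  have "2 + 2 * (p - 1) = 2 * p" using p_ge by simp
  then have "\<not> p - 1 dvd 2 * p"
    using not_dvd_add[of 2 2] p_ge by simp
  then have 1: "S (2 * p) / of_nat (2 * p) \<in> I 1"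
    using p_ge by (intro divided_power_sum_I1) auto
  have "P * (S (2 * p) / of_nat (2 * p)) \<in> I 2"
    by (rule I_mult_ge[OF P_I 1]) simp
  then have "2 * (P * (S (2 * p) / of_nat (2 * p))) \<in> I 2"
    by (rule I_mult_left[OF numeral_I])
  then have "S (2 * p) \<in> I 2" by simp
  then have "P * bernoulli (2 * p) \<in> I 2"
    using power_sum_even[of "2 * p"] p_ge I_diff[of "S (2 * p)" 2 "S (2 * p) - P * bernoulli (2 * p)"] by simp
  then show ?thesis using P_mult_I_iff[of _ 1] by (simp add: numeral_2_eq_2)
qed

text \<open>Both quantities approximate the power sum of index k (p - 1), one by Faulhaber and the
  other by the logarithm.\<close>

lemma P_bernoulli_p_minus_1: "P * bernoulli (p - 1) - (P - 1) * v \<in> I 2"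
  and P_bernoulli_2p_minus_2: "P * bernoulli (2 * p - 2) - (P - 1) * v ^ 2 \<in> I 2"
proof -
  have *: "P * bernoulli (k * (p - 1)) - (P - 1) * v ^ k \<in> I 2" if "k > 0" for k
  proof -
    have n: "even (k * (p - 1))" "k * (p - 1) \<ge> 4"
      using odd_p p_ge that mult_le_mono[of 1 k 4 "p - 1"] by auto
    have "P * bernoulli (k * (p - 1)) - (P - 1) * v ^ k =
      (S (k * (p - 1)) - of_nat (p - 1) * v ^ k) - (S (k * (p - 1)) - P * bernoulli (k * (p - 1)))"
      using p_pos by (simp add: of_nat_diff)
    then show ?thesis
      using I_diff[OF power_sum_multiple[OF that] power_sum_even[OF n]] by (simp only:)
  qed
  show "P * bernoulli (p - 1) - (P - 1) * v \<in> I 2" using *[of 1] by simp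
  show "P * bernoulli (2 * p - 2) - (P - 1) * v ^ 2 \<in> I 2" using *[of 2] by (simp add: diff_mult_distrib2)
qed

lemma not_p_dvd_2880: "\<not> p dvd 2880" and not_p_dvd_6: "\<not> p dvd 6"
proof -
  have *: "\<not> p dvd 2 ^ 6 * (3 ^ 2 * 5)"
  proof
    assume "p dvd 2 ^ 6 * (3 ^ 2 * 5)"
    then have "p dvd 2 \<or> p dvd 3 \<or> p dvd 5"
      using prime_p prime_dvd_mult_iff prime_dvd_power by blast
    then show False using p_ge by (auto dest: dvd_imp_le)
  qed
  then show "\<not> p dvd 2880" by simp
  show "\<not> p dvd 6" using p_ge by (auto dest: dvd_imp_le)
qed

text \<open>Accounts for the first two lines of the formula. The term in B_(2p) arises from p B_(2p)
  / (2 p) = B_(2p) / 2, and S_2 is inserted exactly.\<close>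

lemma bernoulli_terms:
  "(P - 3) * (3 * (S (p + 1) / of_nat (p + 1)) - S (2 * p) / of_nat (2 * p) - 3 / 2 * S 2) -
   (37 * P^3 / 12 - 3 * P^2 + 3 * P / 4 - P^2 * (P * bernoulli (p - 1)) + 3 * P * (P - 3) * \<B> (p + 1)
        - 1/2 * (P - 3 + 11 * P^3 / 2) * bernoulli (2 * p)) \<in> I 4"
proof -
  define s1 s2 where "s1 = S (p + 1) / of_nat (p + 1)" and "s2 = S (2 * p) / of_nat (2 * p)"
  define b c where "b = P * bernoulli (p - 1)" and "c = P * bernoulli (2 * p - 2)"
  have b: "b - (P - 1) * v \<in> I 2" and c: "c - (P - 1) * v ^ 2 \<in> I 2"
    unfolding b_def c_def by (fact P_bernoulli_p_minus_1 P_bernoulli_2p_minus_2)+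
  have B2p: "P * \<B> (2 * p) = bernoulli (2 * p) / 2"
    by (simp add: divided_bernoulli_def)
  have "s1 - (P * \<B> (p + 1) + P ^ 3 * of_nat (p + 1 - 1) / 6 * bernoulli (p + 1 - 2)) \<in> I 4"
    unfolding s1_def using odd_p p_ge by (intro divided_power_sum_even) auto
  also have "P ^ 3 * of_nat (p + 1 - 1) / 6 * bernoulli (p + 1 - 2) = P ^ 3 * b / 6"
    using p_ge by (simp add: b_def numeral_2_eq_2)
  finally have r1: "s1 - (P * \<B> (p + 1) + P ^ 3 * b / 6) \<in> I 4" .
  have "s2 - (P * \<B> (2 * p) + P ^ 3 * of_nat (2 * p - 1) / 6 * bernoulli (2 * p - 2)) \<in> I 4"
    unfolding s2_def using p_ge by (intro divided_power_sum_even) auto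
  also have "P ^ 3 * of_nat (2 * p - 1) / 6 * bernoulli (2 * p - 2) = P ^ 2 * (2 * P - 1) * c / 6"
    using p_ge by (simp add: c_def of_nat_diff power2_eq_square power3_eq_cube)
  finally have r2: "s2 - (bernoulli (2 * p) / 2 + P ^ 2 * (2 * P - 1) * c / 6) \<in> I 4"
    unfolding B2p .
  \<comment> \<open>\<open>P ^ 4 * R / 6\<close> is what remains of the difference once the congruences \<open>b\<close>, \<open>c\<close>,
    \<open>r1\<close>, \<open>r2\<close> and \<open>v = 1 - P * w\<close> have been substituted.\<close>
  define R where "R = - 6 + P - 6 * P * w - 10 * P * w ^ 2 + P ^ 2 * w + 9 * P ^ 2 * w ^ 2 - 2 * P ^ 3 * w ^ 2 + 5 * w + 3 * w ^ 2"
  have RI: "R / of_nat 6 \<in> I 0"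
    unfolding R_def by (intro I_div_unit not_p_dvd_6) (simp only: I_add I_diff I_minus I_mult_0 I_power_0 of_nat_I numeral_I one_I wilson_I)
  have sixth: "x / 6 \<in> I k" if "x \<in> I k" for x k using I_div_unit[OF that not_p_dvd_6] by simp
  have P2: "P ^ 2 * x \<in> I 4" if "x \<in> I 2" for x
    using I_mult[OF P_power_I[of 2] that] by simp
  have P2I: "P ^ 2 * (2 * P - 1) / 6 \<in> I 2"
    by (intro sixth I_mult_right[OF P_power_I] I_diff I_mult_0) auto
  have "(P - 3) * (3 * s1 - s2 - 3 / 2 * S 2) -
   (37 * P^3 / 12 - 3 * P^2 + 3 * P / 4 - P^2 * b + 3 * P * (P - 3) * \<B> (p + 1)
        - 1/2 * (P - 3 + 11 * P^3 / 2) * bernoulli (2 * p)) =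
    (P - 3) * (3 * (s1 - (P * \<B> (p + 1) + P ^ 3 * b / 6))
      - (s2 - (bernoulli (2 * p) / 2 + P ^ 2 * (2 * P - 1) * c / 6)))
    + (P - 3) * P * (P ^ 2 * (b - (P - 1) * v)) / 2 + P ^ 2 * (b - (P - 1) * v)
    - (P - 3) * (P ^ 2 * (2 * P - 1) / 6 * (c - (P - 1) * v ^ 2))
    + 11 * (P ^ 3 * bernoulli (2 * p)) / 2 / 2 + P ^ 4 * (R / of_nat 6)"
    unfolding S_2 v_wilson R_def by (simp add: field_simps eval_nat_numeral)
  also have "\<dots> \<in> I 4"
  proof -
    have P3: "P - 3 \<in> I 0" by (intro I_diff) auto
    have 1: "(P - 3) * (3 * (s1 - (P * \<B> (p + 1) + P ^ 3 * b / 6))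
      - (s2 - (bernoulli (2 * p) / 2 + P ^ 2 * (2 * P - 1) * c / 6))) \<in> I 4"
      by (rule I_mult_left[OF P3 I_diff[OF I_mult_left[OF numeral_I r1] r2]])
    have 2: "P ^ 2 * (2 * P - 1) / 6 * (c - (P - 1) * v ^ 2) \<in> I 4" using I_mult[OF P2I c] by simp
    have 3: "P ^ 3 * bernoulli (2 * p) \<in> I 4"
      using I_mult_ge[OF P_power_I[of 3] bernoulli_2p_I1, of 4] by simp
    have 4: "(P - 3) * P \<in> I 0" by (rule I_mult_0[OF P3 of_nat_I])
    show ?thesis
      by (rule I_add[OF I_add[OF I_diff[OF I_add[OF I_add[OF 1 half_I[OF I_mult_left[OF 4 P2[OF b]]]] P2[OF b]]
        I_mult_left[OF P3 2]] half_I[OF half_I[OF I_mult_left[OF numeral_I 3]]]] I_mult_right[OF P_power_I RI]])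
  qed
  finally show ?thesis unfolding s1_def s2_def b_def .
qed

text \<open>Accounts for the remaining lines, divided by p^2, so precision p^2 suffices. In the
  factor with 7 p / 1440 the two occurrences of B_(p+3) / (p + 3) have cancelled.\<close>

lemma convolution_terms:
  defines "TC \<equiv> fps_nth (G ^ 2) (p + 1)" and "T \<equiv> fps_nth (G ^ 3) (p + 1)" and "U \<equiv> fps_nth (G ^ 3) (2 * p)"
    and "C1 \<equiv> fps_nth (G ^ 2) (p - 1)" and "C3 \<equiv> fps_nth (G ^ 2) (p - 3)"
  shows "P * (P - 3) * U / 3 - (1 / 2 + P * w) * (P - 3) * (TC - P * (T - \<B> 2 * C1)) -
    ((P - 5) * (\<B> (p + 3) - 2 * \<B> 4) * (2 * \<B> (p - 3) - \<B> (2 * p - 4))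
      + 2 * (\<B> (2 * p - 4) - 2 * \<B> (p - 3)) * (2 * \<B> 4 + 7 * P / 1440 + \<B> 4 * (P * bernoulli (p - 1)))
      - P / 2 * (4 / 3 * T - C1 * (\<B> 2 + bernoulli 2) - C3 * (\<B> 4 + bernoulli 4)
         - (\<B> 2)^2 * (\<B> (p - 3) + bernoulli (p - 3)))
      + (1 + P * w) * ((P - 3) / 2) * (2 * \<B> 4 * \<B> (p - 3) - TC)
      - P / 2 * fermat_quotient_sum) \<in> I 2"
proof -
  define g where "g = \<B> (p - 3)"
  define C5 where "C5 = fps_nth (G ^ 2) (p + 3)"
  define D1 D2 where "D1 = \<B> (p + 3)" and "D2 = \<B> (2 * p - 4)"
  define d1 d2 where "d1 = v * \<B> 4 + P * (1 / 144 + C5) / 2" and "d2 = v * g + P * C3 / 2"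
  define b z where "b = P * bernoulli (p - 1)" and
    "z = - 3 * w * (TC - 2 * \<B> 4 * g) + 5 / 3 * T + 2 * U + 2 * \<B> 4 * C3 - 5 * g * (1 / 144 + C5)"
  have C4: "fps_nth (G ^ 2) 4 = 1 / 144"
  proof -
    have "{i. 2 \<le> i \<and> i \<le> p - 3 \<and> i + 2 \<le> 4 \<and> 4 \<le> i + (p - 3)} = {2}" using p_ge by auto
    then show ?thesis by (simp add: G_square_nth divided_bernoulli_2)
  qed
  have G0: "fps_nth (G ^ 2) (2 * p - 4) = 0" using p_ge by (intro G_square_high) auto
  have eq: "4 + (p - 1) = p + 3" "(p - 3) + (p - 1) = 2 * p - 4" using p_ge by auto
  have r1: "D1 - d1 \<in> I 2"
    using divided_bernoulli_lift[of 4] p_ge unfolding eq C4 D1_def d1_def C5_def by simp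
  have r2: "D2 - d2 \<in> I 2"
    using divided_bernoulli_lift[of "p - 3"] p_ge odd_p unfolding eq G0 D2_def d2_def g_def C3_def by simp
  have r3: "b - (P - 1) * v \<in> I 2" unfolding b_def by (fact P_bernoulli_p_minus_1)
  have r4: "fermat_quotient_sum - z \<in> I 1"
    using fermat_quotient_sum_cong unfolding C4 z_def g_def TC_def T_def U_def C3_def C5_def .
  have gI: "g \<in> I 0" "\<B> 4 \<in> I 0" unfolding g_def using p_ge by (auto intro!: divided_bernoulli_I)
  have GI: "TC \<in> I 0" "T \<in> I 0" "U \<in> I 0" "C1 \<in> I 0" "C3 \<in> I 0" "C5 \<in> I 0"
    unfolding TC_def T_def U_def C1_def C3_def C5_def by (rule G_power_I)+
  have PI: "P \<in> I 0" by simp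
  have u144: "1 / 144 \<in> I 0"
  proof -
    have "20 / of_nat 2880 \<in> I 0" by (rule I_div_unit[OF numeral_I not_p_dvd_2880])
    then show ?thesis by simp
  qed
  have u1440: "7 * P / 1440 \<in> I 0"
  proof -
    have "14 * P / of_nat 2880 \<in> I 0" by (intro I_div_unit not_p_dvd_2880 I_mult_0) auto
    then show ?thesis by simp
  qed
  have dI: "d1 \<in> I 0" "d2 \<in> I 0" unfolding d1_def d2_def
    by (intro I_add half_I I_mult_0 v_I PI gI GI u144)+
  have bI: "b \<in> I 0" unfolding b_def by (rule P_bernoulli_I)
  have D2I: "D2 \<in> I 0" using I_cong[OF I_integral[OF r2]] dI by blast
  have B2: "bernoulli 2 = 1 / 6" "bernoulli 4 = - 1 / 30" "\<B> 2 = 1 / 12" "\<B> 4 = - 1 / 120"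
    by (fact bernoulli_2 bernoulli_4 divided_bernoulli_2 divided_bernoulli_4)+
  have Bg: "bernoulli (p - 3) = (P - 3) * g"
    using p_ge by (simp add: g_def divided_bernoulli_def of_nat_diff)
  \<comment> \<open>As in the previous proof; that the remainder is divisible by \<open>P ^ 2\<close> is where all the
    convolution terms cancel.\<close>
  define R where "R = - 120 * C1 - 240 * C1 * P * w + 720 * C1 * w - 3 * C3 - 3600 * C3 * C5 + 720 * C3 * C5 * P + 5 * C3 * P - 12 * C3 * P * w - 36 * C3 * w - 1440 * C5 * P * g * w - 1440 * C5 * g + 7200 * C5 * g * w + 2880 * P * T * w - 10 * P * g * w + 24 * P * g * w ^ 2 + 1440 * T - 8640 * T * w - 1440 * TC * w + 960 * U - 20 * g + 54 * g * w + 72 * g * w ^ 2"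
  have RI: "R / of_nat 2880 \<in> I 0"
    unfolding R_def by (intro I_div_unit not_p_dvd_2880)
      (simp only: I_add I_diff I_minus I_minus_iff I_mult_0 I_power_0 of_nat_I numeral_I one_I wilson_I gI GI)
  have main: "P * (P - 3) * U / 3 - (1 / 2 + P * w) * (P - 3) * (TC - P * (T - 1 / 12 * C1)) -
    ((P - 5) * (d1 - 2 * \<B> 4) * (2 * g - d2)
      + 2 * (d2 - 2 * g) * (2 * \<B> 4 + 7 * P / 1440 + \<B> 4 * ((P - 1) * v))
      - P / 2 * (4 / 3 * T - C1 * (1 / 12 + 1 / 6) - C3 * (\<B> 4 + - 1 / 30)
         - (1 / 12)^2 * (g + (P - 3) * g))
      + (1 + P * w) * ((P - 3) / 2) * (2 * \<B> 4 * g - TC)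
      - P / 2 * z) = P ^ 2 * (R / of_nat 2880)"
    unfolding R_def d1_def d2_def z_def v_wilson B2 by (simp add: field_simps eval_nat_numeral)
  have "P * (P - 3) * U / 3 - (1 / 2 + P * w) * (P - 3) * (TC - P * (T - 1 / 12 * C1)) -
    ((P - 5) * (D1 - 2 * \<B> 4) * (2 * g - D2)
      + 2 * (D2 - 2 * g) * (2 * \<B> 4 + 7 * P / 1440 + \<B> 4 * b)
      - P / 2 * (4 / 3 * T - C1 * (1 / 12 + 1 / 6) - C3 * (\<B> 4 + - 1 / 30)
         - (1 / 12)^2 * (g + (P - 3) * g))
      + (1 + P * w) * ((P - 3) / 2) * (2 * \<B> 4 * g - TC)
      - P / 2 * fermat_quotient_sum) = P ^ 2 * (R / of_nat 2880)
    - (P - 5) * ((2 * g - D2) * (D1 - d1) - (d1 - 2 * \<B> 4) * (D2 - d2))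
    - 2 * ((2 * \<B> 4 + 7 * P / 1440 + \<B> 4 * b) * (D2 - d2) + (d2 - 2 * g) * \<B> 4 * (b - (P - 1) * v))
    + P * (fermat_quotient_sum - z) / 2"
    unfolding main[symmetric] by (simp add: field_simps)
  also have "\<dots> \<in> I 2"
  proof -
    have "P * (fermat_quotient_sum - z) \<in> I 2" using I_mult_ge[OF P_I r4, of 2] by simp
    then show ?thesis
      by (intro I_add[OF I_diff[OF I_diff]] half_I I_mult_right[OF P_power_I RI] I_mult_left[of "P - 5"] I_mult_left[OF numeral_I]
        I_diff[OF I_mult_left[OF _ r1] I_mult_left[OF _ r2]] I_add[OF I_mult_left[OF _ r2] I_mult_left[OF _ r3]])
        (simp_all only: I_add I_diff I_mult_0 PI gI D2I dI bI u1440 numeral_I)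
  qed
  finally show ?thesis unfolding Bg[unfolded g_def] B2(1,2,3) g_def D1_def D2_def b_def .
qed

end

theorem theorem4:
  fixes p :: nat
  assumes "prime p" and "p \<ge> 11"
  shows "let P = (of_nat p :: rat); B = bernoulli; w = wilson_quotient p; q = fermat_quotient p in
    padic_cong p 4 (A_star p (p - 3))
     (- (1 / (P - 3)) *
      ( 37 * P^3 / 12 - 3 * P^2 + 3 * P / 4 - P^2 * (P * B (p - 1))
        + 3 * P * (P - 3) * \<B> (p + 1)
        - 1/2 * (P - 3 + 11 * P^3 / 2) * B (2 * p)
      + P^2 * (P - 5) * (\<B> (p + 3) - 2 * \<B> 4) * (2 * \<B> (p - 3) - \<B> (2 * p - 4))
      + 2 * P * (\<B> (2 * p - 4) - 2 * \<B> (p - 3))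
          * (P * (2 * \<B> 4 - \<B> (p + 3))
             + 1/2 * (7/720 * P^2 + 2 * P * \<B> (p + 3) + 2 * P * \<B> 4 * (P * B (p - 1))))
      - P^3 / 2 * (4/3 * \<T> (p + 1) - \<C> (p - 1) * (\<B> 2 + B 2) - \<C> (p - 3) * (\<B> 4 + B 4)
                   - (\<B> 2)^2 * (\<B> (p - 3) + B (p - 3)))
      + P^2 * (1 + P * w) * ((P - 3) / 2) * (2 * \<B> 4 * \<B> (p - 3) - truncated_conv4 p)
      - P^3 / 2 * (\<Sum>a = 1..p - 1.
                     (\<Sum>i = 6..p - 5. (B i - 2 * \<B> i) / of_nat a ^ i) * (of_nat a * q a)^2)))"
proof -
  interpret large_prime p using assms by unfold_locales
  define TC T U C1 C3 where "TC = fps_nth (G ^ 2) (p + 1)" and "T = fps_nth (G ^ 3) (p + 1)"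
    and "U = fps_nth (G ^ 3) (2 * p)" and "C1 = fps_nth (G ^ 2) (p - 1)" and "C3 = fps_nth (G ^ 2) (p - 3)"
  define H K where "H = fps_nth (eta ^ 2) (p + 1)" and "K = fps_nth (eta ^ 3) (2 * p)"
  define F where "F = 37 * P^3 / 12 - 3 * P^2 + 3 * P / 4 - P^2 * (P * bernoulli (p - 1)) + 3 * P * (P - 3) * \<B> (p + 1)
        - 1/2 * (P - 3 + 11 * P^3 / 2) * bernoulli (2 * p)"
  define W where "W = (P - 5) * (\<B> (p + 3) - 2 * \<B> 4) * (2 * \<B> (p - 3) - \<B> (2 * p - 4))
      + 2 * (\<B> (2 * p - 4) - 2 * \<B> (p - 3)) * (2 * \<B> 4 + 7 * P / 1440 + \<B> 4 * (P * bernoulli (p - 1)))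
      - P / 2 * (4 / 3 * T - C1 * (\<B> 2 + bernoulli 2) - C3 * (\<B> 4 + bernoulli 4)
         - (\<B> 2)^2 * (\<B> (p - 3) + bernoulli (p - 3)))
      + (1 + P * w) * ((P - 3) / 2) * (2 * \<B> 4 * \<B> (p - 3) - TC)
      - P / 2 * fermat_quotient_sum"
  \<comment> \<open>P^2 times \<open>L\<close> is what the terms in \<open>H\<close> and
    \<open>K\<close> contribute after replacement by Bernoulli convolutions; 1/2 + P w is 3/2 -
    v.\<close>
  define L where "L = P * (P - 3) * U / 3 - (1 / 2 + P * w) * (P - 3) * (TC - P * (T - \<B> 2 * C1))"
  define s where "s = 3 * (S (p + 1) / of_nat (p + 1)) - S (2 * p) / of_nat (2 * p)"
  have r1: "e 2 / v - s + 3 / 2 * S 2 + (3 / 2 - v) * H + K / 3 \<in> I 4"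
    unfolding s_def H_def K_def by (rule main_identity)
  have r2: "(P - 3) * (s - 3 / 2 * S 2) - F \<in> I 4"
    unfolding s_def F_def by (rule bernoulli_terms)
  have "p + 1 - 2 = p - 1" by simp
  then have r3: "H - (P ^ 2 * TC - P ^ 3 * (T - \<B> 2 * C1)) \<in> I 4"
    using eta_square_p_plus_1 G'_G_square[of "p + 1"] p_ge unfolding H_def TC_def T_def C1_def by simp
  have r4: "K + P ^ 3 * U \<in> I 4"
    unfolding K_def U_def by (rule eta_cube_cong)
  have "L - W \<in> I 2"
    unfolding L_def W_def TC_def T_def U_def C1_def C3_def by (rule convolution_terms)
  then have r5: "P ^ 2 * (L - W) \<in> I 4" using I_mult[OF P_power_I[of 2]] by fastforce
  have P3: "P - 3 \<in> I 0" by (intro I_diff) auto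
  have h: "3 / 2 - v \<in> I 0" using half_I[OF numeral_I] v_I by (intro I_diff)
  have "(P - 3) * (e 2 / v) - (F + P ^ 2 * W) =
    (P - 3) * (e 2 / v - s + 3 / 2 * S 2 + (3 / 2 - v) * H + K / 3) + ((P - 3) * (s - 3 / 2 * S 2) - F)
    - (P - 3) * ((3 / 2 - v) * (H - (P ^ 2 * TC - P ^ 3 * (T - \<B> 2 * C1)))) - (P - 3) * ((K + P ^ 3 * U) / 3)
    + P ^ 2 * (L - W)"
    unfolding L_def v_wilson by (simp add: field_simps eval_nat_numeral)
  also have "\<dots> \<in> I 4"
    by (intro I_add I_diff I_mult_left[OF P3] I_mult_left[OF h] third_I r1 r2 r3 r4 r5)
  finally have "(P - 3) * (e 2 / v) - (F + P ^ 2 * W) \<in> I 4" .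
  \<comment> \<open>As 0 < p - 3 < p, division by p - 3 preserves the congruence.\<close>
  moreover have "1 / of_nat (p - 3) \<in> I 0" using p_ge by (intro inverse_less_I) auto
  ultimately have "- (1 / of_nat (p - 3) * ((P - 3) * (e 2 / v) - (F + P ^ 2 * W))) \<in> I 4"
    by (intro I_minus I_mult_left)
  also have "- (1 / of_nat (p - 3) * ((P - 3) * (e 2 / v) - (F + P ^ 2 * W))) =
    A_star p (p - 3) - - (1 / (P - 3)) * (F + P ^ 2 * W)"
  proof -
    have "of_nat (p - 3) = P - 3" "P - 3 \<noteq> 0" using p_ge by (auto simp: of_nat_diff)
    then show ?thesis unfolding A_star_eq by (simp add: field_simps)
  qed
  finally have res: "padic_cong p 4 (A_star p (p - 3)) (- (1 / (P - 3)) * (F + P ^ 2 * W))"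
    by (simp only: padic_cong_iff)
  have conv: "\<T> (p + 1) = T" "\<C> (p - 1) = C1" "\<C> (p - 3) = C3" "truncated_conv4 p = TC"
    unfolding T_def C1_def C3_def TC_def
    by (rule bernoulli_triple_conv_G bernoulli_conv_G truncated_conv4_G, simp?)+
  show ?thesis
    unfolding Let_def conv fermat_quotient_sum_def[symmetric]
    by (rule back_subst[of "padic_cong p 4 (A_star p (p - 3))", OF res],
      rule arg_cong[of _ _ "(*) (- (1 / (P - 3)))"])
      (simp add: F_def W_def field_simps power2_eq_square power3_eq_cube)
qed

end
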